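(* Let $\Gamma=\mathrm{PSL}_2(\mathbb{Z})$. The map $G\mapsto(Y_{\mathrm{comb}}(G),\mathbf{r}_G)$ induces a bijection between the set of subgroups of $\Gamma$ and the set of isomorphism classes of pointed bipartite cuboid graphs. In particular, for a subgroup $G\subset\Gamma$, the quotient of the set $\mathrm{Edge}(Y_{\mathrm{comb}}(G))$ by the group $\mathrm{Aut}(Y_{\mathrm{comb}}(G))$ of the automorphisms of $Y_{\mathrm{comb}}(G)$ that preserve the bipartite cuboid structure is in bijection with the conjugacy class of $G$; so $G$ is normal in $\Gamma$ if and only if $\mathrm{Aut}(Y_{\mathrm{comb}}(G))$ acts transitively on $\mathrm{Edge}(Y_{\mathrm{comb}}(G))$.
   Context: A bipartite cuboid graph is a graph (possibly infinite, multiple edges allowed) such that: the vertices are subdivided into two types; the vertices of one type, called (0), can have valency 1 or 2; the vertices of the other type, called (1), can have valency 1 or 3; any edge joins a vertex of one type with a vertex of the other type; and there is a cyclic order on the set of the edges meeting at a vertex of valency 3. A pointed bipartite cuboid graph is the data of a bipartite cuboid graph and an edge of the graph. Isomorphisms (and automorphisms) of bipartite cuboid graphs are graph isomorphisms preserving the types of vertices and the cyclic orders; isomorphisms of pointed graphs also take the chosen edge to the chosen edge. Let $G_0,G_1\subset\Gamma$ be the subgroups of order 2 and 3 generated by the classes of $\left(\begin{smallmatrix}0&-1\\1&0\end{smallmatrix}\right)$ and $u=\left(\begin{smallmatrix}0&1\\-1&1\end{smallmatrix}\right)$ respectively. For a subgroup $G\subset\Gamma$, $\Gamma$ acts on the right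 on the set $G\backslash\Gamma$ of cosets $Gx$. The bipartite cuboid graph $Y_{\mathrm{comb}}(G)$ has as vertices of type (0) the $G_0$-orbits in $G\backslash\Gamma$, as vertices of type (1) the $G_1$-orbits in $G\backslash\Gamma$, and $\mathrm{Edge}(Y_{\mathrm{comb}}(G))=G\backslash\Gamma$; the edge $x\in G\backslash\Gamma$ joins the $G_0$-orbit of $x$ with the $G_1$-orbit of $x$. The cyclic order on the edges at a trivalent vertex, i.e. a 3-element $G_1$-orbit containing $x$, is $x,\ xu,\ xu^2$. The distinguished edge $\mathbf{r}_G$ is the coset $G\in G\backslash\Gamma$.
   Formalization: Bipartite cuboid graphs are required to be connected; without this the bijection fails, e.g. two disjoint edges with one distinguished form a pointed bipartite cuboid graph isomorphic to no Y_comb(G). *)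

theory Defs
  imports "HOL-Analysis.Determinants" "HOL-Algebra.Generated_Groups" "HOL-Algebra.Group_Action"
begin

section \<open>The group \<open>PSL\<^sub>2(\<int>)\<close>\<close>

definition SL2Z :: "(int^2^2) monoid" where
  "SL2Z = \<lparr>carrier = {A. det A = 1}, mult = (**), one = mat 1\<rparr>"

definition PSL2Z :: "(int^2^2) set monoid" where
  "PSL2Z = SL2Z Mod {mat 1, - mat 1}"

definition psl_class :: "int^2^2 \<Rightarrow> (int^2^2) set" where
  "psl_class A = {mat 1, - mat 1} #>\<^bsub>SL2Z\<^esub> A"

definition u_elt :: "(int^2^2) set" where
  "u_elt = psl_class (vector [vector [0, 1], vector [- 1, 1]])"

definition G0 :: "(int^2^2) set set" where
  "G0 = generate PSL2Z {psl_class (vector [vector [0, - 1], vector [1, 0]])}"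

definition G1 :: "(int^2^2) set set" where
  "G1 = generate PSL2Z {u_elt}"


section \<open>Bipartite cuboid graphs\<close>

text \<open>The two types of vertices are kept in two separate components, so every edge automatically
  joins a vertex of type (0) with a vertex of type (1), and multiple edges are allowed.
  The relation \<open>cyc Y v\<close> is only meaningful at trivalent vertices \<open>v\<close> of type (1);
  its value elsewhere is ignored by all definitions below.\<close>

record ('e, 'v, 'w) bigraph =
  edges :: "'e set"
  verts0 :: "'v set"
  verts1 :: "'w set"
  end0 :: "'e \<Rightarrow> 'v"
  end1 :: "'e \<Rightarrow> 'w"
  cyc :: "'w \<Rightarrow> ('e \<times> 'e \<times> 'e) set"

definition star0 :: "('e, 'v, 'w) bigraph \<Rightarrow> 'v \<Rightarrow> 'e set" where
  "star0 Y v = {e \<in> edges Y. end0 Y e = v}"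

definition star1 :: "('e, 'v, 'w) bigraph \<Rightarrow> 'w \<Rightarrow> 'e set" where
  "star1 Y v = {e \<in> edges Y. end1 Y e = v}"

text \<open>The usual axioms of a (total) cyclic order as a ternary relation. Asymmetry
  together with cyclicity forces related elements to be pairwise distinct.\<close>

definition cyclic_order_on :: "'a set \<Rightarrow> ('a \<times> 'a \<times> 'a) set \<Rightarrow> bool" where
  "cyclic_order_on A R \<longleftrightarrow>
     R \<subseteq> A \<times> A \<times> A \<and>
     (\<forall>a b c. (a, b, c) \<in> R \<longrightarrow> (b, c, a) \<in> R) \<and>
     (\<forall>a b c. (a, b, c) \<in> R \<longrightarrow> (c, b, a) \<notin> R) \<and>
     (\<forall>a b c d. (a, b, c) \<in> R \<longrightarrow> (a, c, d) \<in> R \<longrightarrow> (a, b, d) \<in> R) \<and>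
     (\<forall>a\<in>A. \<forall>b\<in>A. \<forall>c\<in>A. a \<noteq> b \<longrightarrow> b \<noteq> c \<longrightarrow> a \<noteq> c \<longrightarrow> (a, b, c) \<in> R \<or> (c, b, a) \<in> R)"

definition adjacent :: "('e, 'v, 'w) bigraph \<Rightarrow> (('v + 'w) \<times> ('v + 'w)) set" where
  "adjacent Y = {(Inl (end0 Y e), Inr (end1 Y e)) | e. e \<in> edges Y} \<union>
                {(Inr (end1 Y e), Inl (end0 Y e)) | e. e \<in> edges Y}"

definition connected_bigraph :: "('e, 'v, 'w) bigraph \<Rightarrow> bool" where
  "connected_bigraph Y \<longleftrightarrow>
     (\<forall>x \<in> verts0 Y <+> verts1 Y. \<forall>y \<in> verts0 Y <+> verts1 Y. (x, y) \<in> (adjacent Y)\<^sup>*)"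

text \<open>Graphs are understood to be connected: the graphs attached to subgroups are
  connected, and the correspondence with subgroups fails for disconnected graphs.
  Note that \<open>card\<close> is 0 on infinite sets, so the valencies below are genuinely finite.\<close>

definition bipartite_cuboid_graph :: "('e, 'v, 'w) bigraph \<Rightarrow> bool" where
  "bipartite_cuboid_graph Y \<longleftrightarrow>
     end0 Y ` edges Y \<subseteq> verts0 Y \<and>
     end1 Y ` edges Y \<subseteq> verts1 Y \<and>
     (\<forall>v \<in> verts0 Y. card (star0 Y v) \<in> {1, 2}) \<and>
     (\<forall>v \<in> verts1 Y. card (star1 Y v) \<in> {1, 3}) \<and>
     (\<forall>v \<in> verts1 Y. card (star1 Y v) = 3 \<longrightarrow> cyclic_order_on (star1 Y v) (cyc Y v)) \<and>
     connected_bigraph Y"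

fun cuboid_iso ::
  "('e, 'v, 'w) bigraph \<Rightarrow> ('f, 'x, 'y) bigraph \<Rightarrow>
     ('e \<Rightarrow> 'f) \<times> ('v \<Rightarrow> 'x) \<times> ('w \<Rightarrow> 'y) \<Rightarrow> bool" where
  "cuboid_iso Y Z (f, f0, f1) \<longleftrightarrow>
     bij_betw f (edges Y) (edges Z) \<and>
     bij_betw f0 (verts0 Y) (verts0 Z) \<and>
     bij_betw f1 (verts1 Y) (verts1 Z) \<and>
     (\<forall>e \<in> edges Y. end0 Z (f e) = f0 (end0 Y e) \<and> end1 Z (f e) = f1 (end1 Y e)) \<and>
     (\<forall>v \<in> verts1 Y. card (star1 Y v) = 3 \<longrightarrow>
        (\<forall>a \<in> star1 Y v. \<forall>b \<in> star1 Y v. \<forall>c \<in> star1 Y v.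
           (a, b, c) \<in> cyc Y v \<longleftrightarrow> (f a, f b, f c) \<in> cyc Z (f1 v)))"

definition Aut :: "('e, 'v, 'w) bigraph \<Rightarrow> (('e \<Rightarrow> 'e) \<times> ('v \<Rightarrow> 'v) \<times> ('w \<Rightarrow> 'w)) monoid" where
  "Aut Y = (let B = BijGroup (edges Y) \<times>\<times> (BijGroup (verts0 Y) \<times>\<times> BijGroup (verts1 Y))
            in B\<lparr>carrier := {\<phi> \<in> carrier B. cuboid_iso Y Y \<phi>}\<rparr>)"

definition pointed_cuboid_graphs :: "(('e, 'v, 'w) bigraph \<times> 'e) set" where
  "pointed_cuboid_graphs = {(Y, e). bipartite_cuboid_graph Y \<and> e \<in> edges Y}"

fun pointed_isomorphic ::
  "('e, 'v, 'w) bigraph \<times> 'e \<Rightarrow> ('f, 'x, 'y) bigraph \<times> 'f \<Rightarrow> bool" where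
  "pointed_isomorphic (Y, e) (Z, e') \<longleftrightarrow> (\<exists>f f0 f1. cuboid_iso Y Z (f, f0, f1) \<and> f e = e')"

definition pointed_iso_rel ::
  "((('e, 'v, 'w) bigraph \<times> 'e) \<times> (('e, 'v, 'w) bigraph \<times> 'e)) set" where
  "pointed_iso_rel = {(p, q). p \<in> pointed_cuboid_graphs \<and> q \<in> pointed_cuboid_graphs \<and>
                              pointed_isomorphic p q}"


section \<open>The graph of a subgroup\<close>

text \<open>The orbit of a coset \<open>C = Gx\<close> under right translation by a subgroup \<open>H\<close>.\<close>

definition right_orbit :: "(int^2^2) set set \<Rightarrow> (int^2^2) set set \<Rightarrow> (int^2^2) set set set" where
  "right_orbit H C = {C #>\<^bsub>PSL2Z\<^esub> g | g. g \<in> H}"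

definition Y_comb ::
  "(int^2^2) set set \<Rightarrow>
     ((int^2^2) set set, (int^2^2) set set set, (int^2^2) set set set) bigraph" where
  "Y_comb G =
     \<lparr>edges = rcosets\<^bsub>PSL2Z\<^esub> G,
      verts0 = right_orbit G0 ` (rcosets\<^bsub>PSL2Z\<^esub> G),
      verts1 = right_orbit G1 ` (rcosets\<^bsub>PSL2Z\<^esub> G),
      end0 = right_orbit G0,
      end1 = right_orbit G1,
      cyc = (\<lambda>v. {(x, x #>\<^bsub>PSL2Z\<^esub> u_elt, x #>\<^bsub>PSL2Z\<^esub> u_elt #>\<^bsub>PSL2Z\<^esub> u_elt) | x. x \<in> v})\<rparr>"

definition base_edge :: "(int^2^2) set set \<Rightarrow> (int^2^2) set set" where
  "base_edge G = G"

definition pointed_Y_comb where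
  "pointed_Y_comb G = (Y_comb G, base_edge G)"

definition conjugacy_class :: "(int^2^2) set set \<Rightarrow> (int^2^2) set set set" where
  "conjugacy_class G =
     {x <#\<^bsub>PSL2Z\<^esub> G #>\<^bsub>PSL2Z\<^esub> inv\<^bsub>PSL2Z\<^esub> x | x. x \<in> carrier PSL2Z}"

end

theory Submission
  imports Defs
begin

text \<open>An edge of a cuboid graph can be moved by the involution that exchanges the two edges at its
  vertex of type (0) and by the permutation of order 3 that rotates the edges at its vertex of type (1).
  Since \<open>PSL\<^sub>2(\<int>)\<close> is the free product of the subgroups generated by \<open>S\<close> and \<open>U\<close>, this amounts to
  a right action of \<open>PSL\<^sub>2(\<int>)\<close> on the edges, which is transitive by connectedness. Sending a pointed graph
  to the stabiliser of its distinguished edge inverts the passage from \<open>G\<close> to its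
  pointed graph, and the stabiliser of the edge \<open>Gx\<close> of the graph of \<open>G\<close> is \<open>x\<^sup>-\<^sup>1Gx\<close>.
  An automorphism carries one edge to another if and only if their stabilisers agree, which gives the statements on
  conjugacy classes and normality.\<close>

section \<open>Matrices and words\<close>

text \<open>The obstacle is well-definedness: g acts through some word in S and U representing it,
  so words that agree in \<open>PSL2Z\<close> must act alike. No free product is formed. A word is
  brought to a normal form by cancelling S^2 and U^3, which changes neither its group element nor
  its action; positivity of matrix entries then shows that the only normal form representing the
  identity is the empty one. Hence a word that is trivial in \<open>PSL2Z\<close> acts trivially.
  Words are read from left to right, in agreement with right translation of cosets. The isomorphism
  from a graph with edge e to the graph of the stabiliser H of e needs no choices: an edge y goes to
  the set of all g that carry e to y, which is a coset of H. Two graphs with equal stabilisers are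
  compared through this common model. Isomorphism classes can be collected into a set only over
  fixed types. The bijection with classes therefore concerns graphs over the types of the coset
  graphs, and a separate existence and uniqueness statement covers graphs over arbitrary
  types.\<close>

definition M22 :: "int \<Rightarrow> int \<Rightarrow> int \<Rightarrow> int \<Rightarrow> int^2^2" where
  "M22 a b c d = vector [vector [a, b], vector [c, d]]"

lemma M22_eq_iff [simp]: "M22 a b c d = M22 a' b' c' d' \<longleftrightarrow> a = a' \<and> b = b' \<and> c = c' \<and> d = d'"
  by (auto simp: M22_def vec_eq_iff forall_2)

lemma M22_mult [simp]:
  "M22 a b c d ** M22 a' b' c' d' = M22 (a*a' + b*c') (a*b' + b*d') (c*a' + d*c') (c*b' + d*d')"
  by (simp add: M22_def vec_eq_iff forall_2 matrix_matrix_mult_def sum_2)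

lemma mat_1_M22: "mat 1 = M22 1 0 0 1"
  by (simp add: M22_def vec_eq_iff forall_2 mat_def)

lemma uminus_M22 [simp]: "- M22 a b c d = M22 (-a) (-b) (-c) (-d)"
  by (simp add: M22_def vec_eq_iff forall_2)

lemma det_M22 [simp]: "det (M22 a b c d) = a * d - b * c"
  by (simp add: M22_def det_2)

lemma M22_exhaust: obtains a b c d where "A = M22 a b c d"
proof -
  have "A = M22 (A$1$1) (A$1$2) (A$2$1) (A$2$2)"
    by (simp add: M22_def vec_eq_iff forall_2)
  then show ?thesis using that by blast
qed

lemma uminus_matrix_mult:
  fixes A B :: "int^2^2"
  shows "(- A) ** B = - (A ** B)" "A ** (- B) = - (A ** B)"
  by (cases A rule: M22_exhaust; cases B rule: M22_exhaust; simp)+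

definition mS :: "int^2^2" where "mS = M22 0 (- 1) 1 0"
definition mU :: "int^2^2" where "mU = M22 0 1 (- 1) 1"

lemma SL2Z_simps [simp]:
  "carrier SL2Z = {A. det A = 1}" "mult SL2Z = (**)" "one SL2Z = mat 1"
  by (simp_all add: SL2Z_def)

lemma group_SL2Z: "group SL2Z"
proof (rule groupI)
  fix A assume "A \<in> carrier SL2Z"
  then show "\<exists>B\<in>carrier SL2Z. B \<otimes>\<^bsub>SL2Z\<^esub> A = \<one>\<^bsub>SL2Z\<^esub>"
  proof (cases A rule: M22_exhaust)
    case (1 a b c d)
    then show ?thesis
      using \<open>A \<in> carrier SL2Z\<close>
      by (intro bexI[of _ "M22 d (-b) (-c) a"]) (auto simp: mat_1_M22 algebra_simps)
  qed
qed (auto simp: det_mul matrix_mul_assoc)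

section \<open>The quotient by the centre, with elements {A, -A}\<close>

abbreviation pm1 :: "(int^2^2) set" where "pm1 \<equiv> {mat 1, - mat 1}"

lemma psl_class_eq: "psl_class A = {A, - A}"
  by (auto simp: psl_class_def r_coset_def uminus_matrix_mult)

lemma psl_class_eq_iff: "psl_class A = psl_class B \<longleftrightarrow> A = B \<or> A = - B"
  by (auto simp: psl_class_eq doubleton_eq_iff)

lemma normal_pm1: "pm1 \<lhd> SL2Z"
proof -
  interpret group SL2Z by (rule group_SL2Z)
  have det: "det (- mat 1 :: int^2^2) = 1" by (simp add: mat_1_M22)
  have sub: "subgroup pm1 SL2Z"
  proof (rule subgroupI)
    have "inv\<^bsub>SL2Z\<^esub> (- mat 1) = - mat 1"
      by (rule inv_equality) (auto simp: det uminus_matrix_mult)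
    moreover have "inv\<^bsub>SL2Z\<^esub> (mat 1) = mat 1" using inv_one by simp
    ultimately show "\<And>a. a \<in> pm1 \<Longrightarrow> inv\<^bsub>SL2Z\<^esub> a \<in> pm1" by auto
  qed (auto simp: det uminus_matrix_mult)
  show ?thesis
    by (rule normalI[OF sub]) (auto simp: r_coset_def l_coset_def uminus_matrix_mult)
qed

lemma group_PSL2Z: "group PSL2Z"
  unfolding PSL2Z_def by (rule normal.factorgroup_is_group[OF normal_pm1])

lemma carrier_PSL2Z: "carrier PSL2Z = psl_class ` {A. det A = 1}"
  by (auto simp: PSL2Z_def FactGroup_def RCOSETS_def psl_class_def)

lemma one_PSL2Z: "\<one>\<^bsub>PSL2Z\<^esub> = psl_class (mat 1)"
  by (simp add: PSL2Z_def FactGroup_def psl_class_eq)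

lemma psl_class_mult:
  "det A = 1 \<Longrightarrow> det B = 1 \<Longrightarrow> psl_class A \<otimes>\<^bsub>PSL2Z\<^esub> psl_class B = psl_class (A ** B)"
  unfolding PSL2Z_def psl_class_def
  using normal.rcos_sum[OF normal_pm1, of A B] by (simp add: FactGroup_def)

section \<open>Words in U (\<open>True\<close>) and S (\<open>False\<close>), and their surjectivity
  onto the group\<close>

primrec letter :: "bool \<Rightarrow> int^2^2" where
  "letter True = mU" | "letter False = mS"

definition word_mat :: "bool list \<Rightarrow> int^2^2" where
  "word_mat w = foldr (\<lambda>b A. letter b ** A) w (mat 1)"

lemma word_mat_simps [simp]:
  "word_mat [] = mat 1" "word_mat (b # w) = letter b ** word_mat w"
  by (simp_all add: word_mat_def)

lemma word_mat_append [simp]: "word_mat (v @ w) = word_mat v ** word_mat w"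
  by (induction v) (simp_all add: matrix_mul_assoc)

lemma det_letter [simp]: "det (letter b) = 1"
  by (cases b) (simp_all add: mS_def mU_def)

lemma det_word_mat [simp]: "det (word_mat w) = 1"
  by (induction w) (simp_all add: det_mul)

definition word_elt :: "bool list \<Rightarrow> (int^2^2) set" where
  "word_elt w = psl_class (word_mat w)"

lemma word_elt_Nil: "word_elt [] = \<one>\<^bsub>PSL2Z\<^esub>"
  by (simp add: word_elt_def one_PSL2Z)

lemma word_elt_append: "word_elt (v @ w) = word_elt v \<otimes>\<^bsub>PSL2Z\<^esub> word_elt w"
  by (simp add: word_elt_def psl_class_mult)

lemma word_elt_carrier: "word_elt w \<in> carrier PSL2Z"
  by (auto simp: word_elt_def carrier_PSL2Z)

text \<open>Euclidean algorithm on the bottom row: right multiplication by \<open>SU\<close> subtracts the first column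
  from the second, right multiplication by \<open>S\<close> swaps the columns up to sign.\<close>

lemma word_elt_shear_nat:
  "\<exists>w. psl_class (M22 1 (int n) 0 1) = word_elt w" "\<exists>w. psl_class (M22 1 (- int n) 0 1) = word_elt w"
proof (induction n)
  case (Suc n)
  \<comment> \<open>SU is the shear by -1 up to sign, and its inverse is U^2 S because S has order 2
    and U has order 3 in the quotient.\<close>
  have "psl_class (M22 1 1 0 1) = word_elt [True, True, False]"
    "psl_class (M22 1 (-1) 0 1) = word_elt [False, True]"
    by (simp_all add: word_elt_def mS_def mU_def mat_1_M22)
  moreover have "psl_class (M22 1 (int (Suc n)) 0 1) = psl_class (M22 1 (int n) 0 1) \<otimes>\<^bsub>PSL2Z\<^esub> psl_class (M22 1 1 0 1)"
    "psl_class (M22 1 (- int (Suc n)) 0 1) = psl_class (M22 1 (- int n) 0 1) \<otimes>\<^bsub>PSL2Z\<^esub> psl_class (M22 1 (-1) 0 1)"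
    by (simp_all add: psl_class_mult)
  ultimately show "\<exists>w. psl_class (M22 1 (int (Suc n)) 0 1) = word_elt w" 
    "\<exists>w. psl_class (M22 1 (- int (Suc n)) 0 1) = word_elt w"
    using Suc by (metis word_elt_append)+
qed (auto intro!: exI[of _ "[]"] simp: word_elt_def mat_1_M22)

lemma word_elt_shear: "\<exists>w. psl_class (M22 1 k 0 1) = word_elt w"
  by (cases k rule: int_cases2) (use word_elt_shear_nat in auto)

lemma word_elt_surj:
  assumes "g \<in> carrier PSL2Z"
  obtains w where "g = word_elt w"
proof -
  have "\<exists>w. psl_class (M22 a b c d) = word_elt w" if "a * d - b * c = 1" for a b c d
    using that
  proof (induction "nat \<bar>c\<bar>" arbitrary: a b c d rule: less_induct)
    case less
    show ?case
    proof (cases "c = 0")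
      case True
      then have "a = 1 \<and> d = 1 \<or> a = -1 \<and> d = -1"
        using less.prems by (auto simp: zmult_eq_1_iff)
      \<comment> \<open>If a = d = -1, changing the sign of the whole matrix turns b into -b, which
        is a * b.\<close>
      then have "psl_class (M22 a b c d) = psl_class (M22 1 (a * b) 0 1)"
        using True by (auto simp: psl_class_eq_iff)
      then show ?thesis using word_elt_shear by metis
    next
      case False
      \<comment> \<open>The induction hypothesis is applied to M T^(-q) S, where M is the given
        matrix and T^q the shear by q. Its lower left entry is the remainder d mod c. Multiplying
        back by S and T^q gives -M, since S^2 = -1, and the class ignores the sign.\<close>
      define q where "q = d div c"
      have r: "d - c * q = d mod c" by (simp add: q_def minus_mult_div_eq_mod)
      have 1: "nat \<bar>d - c * q\<bar> < nat \<bar>c\<bar>" unfolding r using False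
        by (simp add: abs_mod_less)
      have 2: "(b - a * q) * (- c) - (- a) * (d - c * q) = 1"
        using less.prems by (simp add: algebra_simps)
      obtain w where w: "psl_class (M22 (b - a * q) (- a) (d - c * q) (- c)) = word_elt w"
        using less.hyps[OF 1 2] by blast
      obtain v where v: "psl_class (M22 1 q 0 1) = word_elt v" using word_elt_shear by blast
      have "word_elt (w @ [False] @ v) = 
          psl_class (M22 (b - a * q) (- a) (d - c * q) (- c)) \<otimes>\<^bsub>PSL2Z\<^esub> (psl_class mS \<otimes>\<^bsub>PSL2Z\<^esub> psl_class (M22 1 q 0 1))"
        unfolding word_elt_append w v by (simp add: word_elt_def)
      also have "\<dots> = psl_class (M22 a b c d)"
        using less.prems by (simp add: psl_class_mult mS_def psl_class_eq_iff algebra_simps)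
      finally show ?thesis by metis
    qed
  qed
  moreover obtain A where "g = psl_class A" "det A = 1" using assms by (auto simp: carrier_PSL2Z)
  moreover obtain a b c d where "A = M22 a b c d" by (rule M22_exhaust)
  ultimately show ?thesis using that by fastforce
qed

section \<open>Freeness\<close>

text \<open>The syllables S U^2 and S U. An initial power of U, a sequence of such blocks and an
  optional final S make up exactly the reduced words in generators of orders 2 and 3.\<close>

definition blocks :: "bool list \<Rightarrow> bool list" where
  "blocks m = concat (map (\<lambda>b. if b then [False, True, True] else [False, True]) m)"

lemma blocks_simps [simp]:
  "blocks [] = []" 
  "blocks (b # m) = (if b then [False, True, True] else [False, True]) @ blocks m"
  "blocks (m @ m') = blocks m @ blocks m'"
  by (simp_all add: blocks_def)

text \<open>The head of the word acts first, so concatenation of words corresponds to a right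
  action.\<close>

primrec run :: "('a \<Rightarrow> 'a) \<Rightarrow> ('a \<Rightarrow> 'a) \<Rightarrow> bool list \<Rightarrow> 'a \<Rightarrow> 'a" where
  "run s t [] x = x"
| "run s t (b # w) x = run s t w (if b then t x else s x)"

lemma run_append [simp]: "run s t (v @ w) x = run s t w (run s t v x)"
  by (induction v arbitrary: x) auto

text \<open>The word is picked by choice from g alone, so the same word serves every set and every
  pair s, t. Independence of the choice on a \<open>modular_set\<close> is
  \<open>run_cong\<close>.\<close>

definition act :: "('a \<Rightarrow> 'a) \<Rightarrow> ('a \<Rightarrow> 'a) \<Rightarrow> 'a \<Rightarrow> (int^2^2) set \<Rightarrow> 'a" where
  "act s t x g = run s t (SOME w. g = word_elt w) x"

text \<open>These are the right sets of a free product of cyclic groups of orders 2 and 3. Fixed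
  points are allowed; they come from univalent vertices.\<close>

locale modular_set =
  fixes E :: "'a set" and s t :: "'a \<Rightarrow> 'a"
  assumes s_closed [simp]: "x \<in> E \<Longrightarrow> s x \<in> E" and t_closed [simp]: "x \<in> E \<Longrightarrow> t x \<in> E"
    and s_s [simp]: "x \<in> E \<Longrightarrow> s (s x) = x" and t_t_t [simp]: "x \<in> E \<Longrightarrow> t (t (t x)) = x"
begin

lemma run_closed [simp]: "x \<in> E \<Longrightarrow> run s t w x \<in> E"
  by (induction w arbitrary: x) auto

text \<open>Both invariants are carried together: the group element shows which normal form a word
  has, and the action on E is what has to be computed from it.\<close>

definition weq :: "bool list \<Rightarrow> bool list \<Rightarrow> bool" where
  "weq v w \<longleftrightarrow> word_elt v = word_elt w \<and> (\<forall>x\<in>E. run s t v x = run s t w x)"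

lemma weq_refl [simp]: "weq w w"
  and weq_trans [trans]: "weq u v \<Longrightarrow> weq v w \<Longrightarrow> weq u w"
  and weq_append: "weq v w \<Longrightarrow> weq (v @ u) (w @ u)"
  by (simp_all add: weq_def word_elt_append)

lemma weq_cancel_S: "weq (w @ [False, False]) w"
  and weq_cancel_U: "weq (w @ [True, True, True]) w"
proof -
  interpret group PSL2Z by (rule group_PSL2Z)
  have "word_elt [False, False] = \<one>\<^bsub>PSL2Z\<^esub>" "word_elt [True, True, True] = \<one>\<^bsub>PSL2Z\<^esub>"
    by (simp_all add: word_elt_def one_PSL2Z psl_class_eq_iff mS_def mU_def mat_1_M22)
  then show "weq (w @ [False, False]) w" "weq (w @ [True, True, True]) w"
    by (simp_all add: weq_def word_elt_append word_elt_carrier)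
qed

text \<open>Letters are appended at the right end, so only the last syllable changes and a
  cancellation is ever required only at the end of the word.\<close>

lemma weq_normal_form:
  obtains i m k where "i < 3" "k < 2" "weq w (replicate i True @ blocks m @ replicate k False)"
proof -
  have "\<exists>i m k. i < 3 \<and> k < 2 \<and> weq w (replicate i True @ blocks m @ replicate k False)"
  proof (induction w rule: rev_induct)
    case Nil
    show ?case by (intro exI[of _ "0::nat"] exI[of _ "[]"]) simp
  next
    case (snoc b w)
    then obtain i m k where ik: "i < 3" "k < 2"
      and weq: "weq w (replicate i True @ blocks m @ replicate k False)" by blast
    have weq': "weq (w @ [b]) ((replicate i True @ blocks m @ replicate k False) @ [b])"
      using weq by (rule weq_append)
    have wit: ?case if "i < 3" "k < 2" "weq (w @ [b]) (replicate i True @ blocks m @ replicate k False)"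
      for i m k using that by blast
    consider (S0) "\<not> b" "k = 0" | (S1) "\<not> b" "k = 1" | (U1) "b" "k = 1" | (Ui) "b" "k = 0" "m = []" "i < 2"
      | (U2) "b" "k = 0" "m = []" "i = 2"
      | (SU) m' where "b" "k = 0" "m = m' @ [False]" | (SUU) m' where "b" "k = 0" "m = m' @ [True]"
      using ik by (cases m rule: rev_cases) (auto simp: less_Suc_eq numeral_2_eq_2 numeral_3_eq_3)
    then show ?case
    proof cases
      case S0
      with ik weq' show ?thesis by (intro wit[of i 1 m]) simp_all
    next
      case S1
      with weq' weq_trans[OF _ weq_cancel_S[of "replicate i True @ blocks m"]] ik
      show ?thesis by (intro wit[of i 0 m]) simp_all
    next
      case U1
      with ik weq' show ?thesis by (intro wit[of i 0 "m @ [False]"]) simp_all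
    next
      case Ui
      with weq' show ?thesis
        by (intro wit[of "Suc i" 0 "[]"]) (simp_all add: replicate_append_same)
    next
      case U2
      with weq' weq_trans[OF _ weq_cancel_U[of "[]"]]
      show ?thesis by (intro wit[of 0 0 "[]"]) (simp_all add: numeral_2_eq_2)
    next
      case SU
      with ik weq' show ?thesis by (intro wit[of i 0 "m' @ [True]"]) simp_all
    next
      \<comment> \<open>The last block becomes S U^3. The cube cancels, and the S that opened the
        block is left over as the final letter, so k becomes 1.\<close>
      case SUU
      with weq' weq_trans[OF _ weq_cancel_U[of "replicate i True @ blocks m' @ [False]"]] ik
      show ?thesis by (intro wit[of i 1 m']) simp_all
    qed
  qed
  then show ?thesis using that by blast
qed

end

text \<open>Conjugating by the diagonal matrix with entries \<open>1, -1\<close> makes the matrices of \<open>SU\<close> and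
  \<open>SU\<^sup>2\<close> nonnegative, so no cancellation can occur in a product of these blocks.\<close>

lemma word_elt_blocks:
  obtains a b c d where "word_elt (blocks m) = psl_class (M22 a (- b) (- c) d)"
    "a \<ge> 1" "d \<ge> 1" "b \<ge> 0" "c \<ge> 0" "a * d - b * c = 1" "m = [] \<or> b \<ge> 1 \<or> c \<ge> 1"
proof -
  have "\<exists>a b c d. word_elt (blocks m) = psl_class (M22 a (- b) (- c) d) \<and>
    a \<ge> 1 \<and> d \<ge> 1 \<and> b \<ge> 0 \<and> c \<ge> 0 \<and> a * d - b * c = 1 \<and> (m = [] \<or> b \<ge> 1 \<or> c \<ge> 1)"
  proof (induction m)
    case Nil
    show ?case
      by (rule exI[of _ 1], rule exI[of _ 0], rule exI[of _ 0], rule exI[of _ 1]) (simp add: word_elt_def mat_1_M22)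
  next
    case (Cons x m)
    then obtain a b c d where IH: "word_elt (blocks m) = psl_class (M22 a (- b) (- c) d)"
      "a \<ge> 1" "d \<ge> 1" "b \<ge> 0" "c \<ge> 0" "a * d - b * c = 1" by blast
    have wit: ?case if "word_elt (blocks (x # m)) = psl_class (M22 a (- b) (- c) d)"
      "a \<ge> 1" "d \<ge> 1" "b \<ge> 0" "c \<ge> 0" "a * d - b * c = 1" "b \<ge> 1 \<or> c \<ge> 1" for a b c d
      using that by blast
    \<comment> \<open>After the change of signs, left multiplication by SU adds the second row to
      the first, and by SU^2 the first to the second. Nonnegativity survives, and since the diagonal
      entries are at least 1, an off-diagonal entry becomes positive.\<close>
    have U: "word_elt [False, True] = psl_class (M22 1 (-1) 0 1)"
      and U2: "word_elt [False, True, True] = psl_class (M22 1 0 (-1) 1)"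
      by (simp_all add: word_elt_def mS_def mU_def mat_1_M22 psl_class_eq_iff)
    show ?case
    proof (cases x)
      case True
      then have "word_elt (blocks (x # m)) = psl_class (M22 a (- b) (- (a + c)) (b + d))"
        using IH by (simp add: word_elt_append psl_class_mult U2 del: append.simps)
      with IH show ?thesis
        by (intro wit[of a b "a + c" "b + d"]) (simp_all add: algebra_simps)
    next
      case False
      then have "word_elt (blocks (x # m)) = psl_class (M22 (a + c) (- (b + d)) (- c) d)"
        using IH by (simp add: word_elt_append psl_class_mult U del: append.simps)
      with IH show ?thesis
        by (intro wit[of "a + c" "b + d" c d]) (simp_all add: algebra_simps)
    qed
  qed
  then show ?thesis using that by blast
qed

lemma normal_form_eq_one:
  assumes "i < 3" "k < 2" and one: "word_elt (replicate i True @ blocks m @ replicate k False) = \<one>\<^bsub>PSL2Z\<^esub>"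
  shows "i = 0 \<and> m = [] \<and> k = 0"
proof -
  obtain a b c d where m: "word_elt (blocks m) = psl_class (M22 a (- b) (- c) d)"
    and pos: "a \<ge> 1" "d \<ge> 1" "b \<ge> 0" "c \<ge> 0" "a * d - b * c = 1" "m = [] \<or> b \<ge> 1 \<or> c \<ge> 1"
    by (rule word_elt_blocks)
  have "word_elt (replicate i True @ blocks m @ replicate k False) =
    psl_class (word_mat (replicate i True) ** (M22 a (- b) (- c) d ** word_mat (replicate k False)))"
    using pos unfolding word_elt_append m by (simp add: word_elt_def psl_class_mult det_mul)
  with one have "word_mat (replicate i True) ** (M22 a (- b) (- c) d ** word_mat (replicate k False)) \<in> {mat 1, - mat 1}"
    by (auto simp: one_PSL2Z psl_class_eq_iff)
  \<comment> \<open>Six products remain. Unless i = k = 0, some off-diagonal entry is up to sign one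
    of a, d, a + c, b + d, all of which are at least 1, so the product is not plus or minus the
    identity. For i = k = 0 it forces b = c = 0, hence m is empty.\<close>
  moreover have "i = 0 \<or> i = 1 \<or> i = 2" "k = 0 \<or> k = 1" using assms by auto
  ultimately show ?thesis
    using pos by (elim disjE) (auto simp: mS_def mU_def mat_1_M22 numeral_2_eq_2)
qed

context modular_set
begin

text \<open>This is freeness in the form used later: the normal form of a word trivial in
  \<open>PSL2Z\<close> is empty, and \<open>weq\<close> says that the word acts like its normal
  form.\<close>

lemma run_word_elt_one:
  assumes "word_elt w = \<one>\<^bsub>PSL2Z\<^esub>" "x \<in> E"
  shows "run s t w x = x"
proof -
  obtain i m k where ik: "i < 3" "k < 2" and "weq w (replicate i True @ blocks m @ replicate k False)"
    by (rule weq_normal_form)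
  moreover from this assms have "i = 0 \<and> m = [] \<and> k = 0"
    by (intro normal_form_eq_one) (auto simp: weq_def)
  ultimately show ?thesis using assms by (auto simp: weq_def)
qed

lemma run_cong:
  assumes "word_elt v = word_elt w" "x \<in> E"
  shows "run s t v x = run s t w x"
proof -
  interpret group PSL2Z by (rule group_PSL2Z)
  obtain v' where v': "inv\<^bsub>PSL2Z\<^esub> (word_elt v) = word_elt v'"
    using word_elt_surj word_elt_carrier inv_closed by metis
  \<comment> \<open>With v' a word for the inverse, both v v' and v' w are trivial. Running v v' w
    from x then yields the effect of w and also the effect of v.\<close>
  have "word_elt (v @ v') = \<one>\<^bsub>PSL2Z\<^esub>" "word_elt (v' @ w) = \<one>\<^bsub>PSL2Z\<^esub>"
    using assms(1) by (simp_all add: word_elt_append word_elt_carrier flip: v')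
  then have "run s t (v @ v') x = x" "run s t (v' @ w) (run s t v x) = run s t v x"
    using assms(2) run_word_elt_one run_closed by blast+
  then show ?thesis by simp
qed

lemma act_word_elt:
  assumes "x \<in> E"
  shows "act s t x (word_elt w) = run s t w x"
proof -
  have "word_elt w = word_elt (SOME v. word_elt w = word_elt v)"
    by (rule someI[of _ w]) simp
  with assms show ?thesis unfolding act_def using run_cong by metis
qed

lemma act_closed: "x \<in> E \<Longrightarrow> act s t x g \<in> E"
  by (simp add: act_def)

lemma act_one: "x \<in> E \<Longrightarrow> act s t x \<one>\<^bsub>PSL2Z\<^esub> = x"
  by (simp add: act_word_elt flip: word_elt_Nil)

lemma act_mult:
  assumes "x \<in> E" "g \<in> carrier PSL2Z" "h \<in> carrier PSL2Z"
  shows "act s t x (g \<otimes>\<^bsub>PSL2Z\<^esub> h) = act s t (act s t x g) h"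
proof -
  obtain v w where "g = word_elt v" "h = word_elt w" using assms word_elt_surj by metis
  with assms show ?thesis by (simp add: act_word_elt flip: word_elt_append)
qed

end

section \<open>The action on the edges of a cuboid graph\<close>

text \<open>Totality puts one of the two orientations of the three points into R, cyclicity adds its
  rotations, and asymmetry excludes the other orientation and all triples with a repetition. The
  names b, c follow the orientation found.\<close>

lemma cyclic_order_on_card_3:
  assumes "card A = 3" "cyclic_order_on A R" "a \<in> A"
  obtains b c where "A = {a, b, c}" "a \<noteq> b" "b \<noteq> c" "a \<noteq> c" "R = {(a, b, c), (b, c, a), (c, a, b)}"
proof -
  note R = assms(2)[unfolded cyclic_order_on_def]
  have sub: "R \<subseteq> A \<times> A \<times> A"
    using R by (rule conjunct1)
  have cyc: "(y, z, x) \<in> R" if "(x, y, z) \<in> R" for x y z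
    using R[THEN conjunct2, THEN conjunct1] that by iprover
  have asym: "(z, y, x) \<notin> R" if "(x, y, z) \<in> R" for x y z
    using R[THEN conjunct2, THEN conjunct2, THEN conjunct1] that by iprover
  have tot: "(x, y, z) \<in> R \<or> (z, y, x) \<in> R"
    if "x \<in> A" "y \<in> A" "z \<in> A" "x \<noteq> y" "y \<noteq> z" "x \<noteq> z" for x y z
    using R[THEN conjunct2, THEN conjunct2, THEN conjunct2, THEN conjunct2] that by blast
  have distinct: "x \<noteq> y" "y \<noteq> z" "x \<noteq> z" if "(x, y, z) \<in> R" for x y z
    using that asym[OF that] cyc[OF that] asym[OF cyc[OF that]] asym[OF cyc[OF cyc[OF that]]] by auto
  have R: "R = {(a, b, c), (b, c, a), (c, a, b)}" if "A = {a, b, c}" "(a, b, c) \<in> R" for b c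
  proof -
    have "(b, c, a) \<in> R" "(c, a, b) \<in> R" using cyc[OF that(2)] cyc[OF cyc[OF that(2)]] by auto
    moreover have "(c, b, a) \<notin> R" "(a, c, b) \<notin> R" "(b, a, c) \<notin> R"
      using asym[OF that(2)] asym[OF calculation(1)] asym[OF calculation(2)] by auto
    moreover have "p \<in> {(a, b, c), (b, c, a), (c, a, b), (c, b, a), (a, c, b), (b, a, c)}" if "p \<in> R" for p
    proof -
      obtain x y z where p: "p = (x, y, z)" by (cases p)
      with \<open>p \<in> R\<close> sub \<open>A = {a, b, c}\<close> have "x \<in> {a, b, c}" "y \<in> {a, b, c}" "z \<in> {a, b, c}" by auto
      with p distinct[of x y z] \<open>p \<in> R\<close> show ?thesis by auto
    qed
    ultimately show ?thesis using that(2) by blast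
  qed
  obtain b c where bc: "A = {a, b, c}" "a \<noteq> b" "b \<noteq> c" "a \<noteq> c"
  proof -
    have "card (A - {a}) = 2" using assms by simp
    then obtain b c where "A - {a} = {b, c}" "b \<noteq> c" by (auto simp: card_2_iff)
    then show ?thesis using that[of b c] assms(3) by blast
  qed
  then consider "(a, b, c) \<in> R" | "(a, c, b) \<in> R" using tot[of a b c] cyc[of c b a] cyc[of b a c] by blast
  then show ?thesis
  proof cases
    case 1
    then show ?thesis using that[of b c] R[of b c] bc by blast
  next
    case 2
    have "A = {a, c, b}" using bc by blast
    then show ?thesis using 2 that[of c b] R[of c b] bc by blast
  qed
qed

text \<open>One set equation serves both valencies: at a univalent vertex the star is {e}, which
  forces e' = e.\<close>

definition flip_edge :: "('e, 'v, 'w) bigraph \<Rightarrow> 'e \<Rightarrow> 'e" where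
  "flip_edge Y e = (THE e'. star0 Y (end0 Y e) = {e, e'})"

text \<open>At a univalent vertex the value of \<open>cyc\<close> is meaningless, so the edge is
  fixed there explicitly; either way the third iterate is the identity.\<close>

definition turn_edge :: "('e, 'v, 'w) bigraph \<Rightarrow> 'e \<Rightarrow> 'e" where
  "turn_edge Y e = (if card (star1 Y (end1 Y e)) = 3 then THE b. \<exists>c. (e, b, c) \<in> cyc Y (end1 Y e) else e)"

lemma flip_edge_eqI: "star0 Y (end0 Y e) = {e, e'} \<Longrightarrow> flip_edge Y e = e'"
  unfolding flip_edge_def by (rule the_equality) (auto simp: doubleton_eq_iff)

lemma star0_iff: "e \<in> star0 Y v \<longleftrightarrow> e \<in> edges Y \<and> end0 Y e = v"
  and star1_iff: "e \<in> star1 Y w \<longleftrightarrow> e \<in> edges Y \<and> end1 Y e = w"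
  by (auto simp: star0_def star1_def)

locale cuboid =
  fixes Y :: "('e, 'v, 'w) bigraph"
  assumes cuboid: "bipartite_cuboid_graph Y"
begin

lemma end_closed: "e \<in> edges Y \<Longrightarrow> end0 Y e \<in> verts0 Y" "e \<in> edges Y \<Longrightarrow> end1 Y e \<in> verts1 Y"
  using cuboid by (auto simp: bipartite_cuboid_graph_def)

lemma star0_nonempty: "v \<in> verts0 Y \<Longrightarrow> star0 Y v \<noteq> {}"
  and star1_nonempty: "w \<in> verts1 Y \<Longrightarrow> star1 Y w \<noteq> {}"
  using cuboid by (fastforce simp: bipartite_cuboid_graph_def)+

lemma verts_eq: "verts0 Y = end0 Y ` edges Y" "verts1 Y = end1 Y ` edges Y"
  using star0_nonempty star1_nonempty end_closed by (fastforce simp: star0_def star1_def)+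

lemma star0_end0: "e \<in> edges Y \<Longrightarrow> star0 Y (end0 Y e) = {e, flip_edge Y e}"
proof -
  assume e: "e \<in> edges Y"
  then have "card (star0 Y (end0 Y e)) \<in> {1, 2}"
    using cuboid by (auto simp: bipartite_cuboid_graph_def)
  moreover have "e \<in> star0 Y (end0 Y e)" using e by (simp add: star0_iff)
  ultimately obtain e' where "star0 Y (end0 Y e) = {e, e'}"
    by (auto simp: card_1_singleton_iff card_2_iff doubleton_eq_iff)
  then show ?thesis using flip_edge_eqI by metis
qed

lemma flip_edge_closed: "e \<in> edges Y \<Longrightarrow> flip_edge Y e \<in> edges Y"
  and end0_flip_edge: "e \<in> edges Y \<Longrightarrow> end0 Y (flip_edge Y e) = end0 Y e"
  using star0_end0[of e] star0_iff[of _ Y "end0 Y e"] by blast+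

lemma flip_edge_flip_edge: "e \<in> edges Y \<Longrightarrow> flip_edge Y (flip_edge Y e) = e"
  using star0_end0 by (intro flip_edge_eqI) (auto simp: end0_flip_edge)

lemma card_star1: "e \<in> edges Y \<Longrightarrow> card (star1 Y (end1 Y e)) = 1 \<or> card (star1 Y (end1 Y e)) = 3"
  using cuboid by (auto simp: bipartite_cuboid_graph_def)

lemma turn_edge_univalent:
  assumes "e \<in> edges Y" "card (star1 Y (end1 Y e)) \<noteq> 3"
  shows "turn_edge Y e = e" "star1 Y (end1 Y e) = {e}"
proof -
  have "e \<in> star1 Y (end1 Y e)" using assms by (simp add: star1_iff)
  then show "star1 Y (end1 Y e) = {e}"
    using card_star1[OF assms(1)] assms(2) by (auto simp: card_1_singleton_iff)
qed (use assms in \<open>simp add: turn_edge_def\<close>)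

lemma turn_edge_trivalent:
  assumes e: "e \<in> edges Y" and 3: "card (star1 Y (end1 Y e)) = 3"
  obtains b c where "star1 Y (end1 Y e) = {e, b, c}" "e \<noteq> b" "b \<noteq> c" "e \<noteq> c"
    "cyc Y (end1 Y e) = {(e, b, c), (b, c, e), (c, e, b)}"
    "turn_edge Y e = b" "turn_edge Y b = c" "turn_edge Y c = e"
proof -
  have cyc: "cyclic_order_on (star1 Y (end1 Y e)) (cyc Y (end1 Y e))"
    using cuboid 3 e by (auto simp: bipartite_cuboid_graph_def)
  have "e \<in> star1 Y (end1 Y e)" using e by (simp add: star1_iff)
  from cyclic_order_on_card_3[OF 3 cyc this]
  obtain b c where bc: "star1 Y (end1 Y e) = {e, b, c}" "e \<noteq> b" "b \<noteq> c" "e \<noteq> c"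
    "cyc Y (end1 Y e) = {(e, b, c), (b, c, e), (c, e, b)}" .
  have turn: "turn_edge Y x = y"
    if "x \<in> star1 Y (end1 Y e)" "\<And>y'. (\<exists>z. (x, y', z) \<in> cyc Y (end1 Y e)) \<longleftrightarrow> y' = y" for x y
    using that 3 by (simp add: turn_edge_def star1_iff)
  have "turn_edge Y e = b" by (rule turn) (use bc in auto)
  moreover have "turn_edge Y b = c" by (rule turn) (use bc in auto)
  moreover have "turn_edge Y c = e" by (rule turn) (use bc in auto)
  ultimately show ?thesis using bc that by blast
qed

lemma star1_end1:
  assumes e: "e \<in> edges Y"
  shows "star1 Y (end1 Y e) = {e, turn_edge Y e, turn_edge Y (turn_edge Y e)}"
proof (cases "card (star1 Y (end1 Y e)) = 3")
  case True
  obtain b c where "star1 Y (end1 Y e) = {e, b, c}" "turn_edge Y e = b" "turn_edge Y b = c" "turn_edge Y c = e"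
    by (rule turn_edge_trivalent[OF e True])
  then show ?thesis by simp
next
  case False
  show ?thesis by (simp add: turn_edge_univalent[OF e False])
qed

lemma turn_edge_closed: "e \<in> edges Y \<Longrightarrow> turn_edge Y e \<in> edges Y"
  using star1_end1[of e] star1_iff[of _ Y "end1 Y e"] by blast

lemma turn_edge_cubed:
  assumes e: "e \<in> edges Y"
  shows "turn_edge Y (turn_edge Y (turn_edge Y e)) = e"
proof (cases "card (star1 Y (end1 Y e)) = 3")
  case True
  obtain b c where "star1 Y (end1 Y e) = {e, b, c}" "turn_edge Y e = b" "turn_edge Y b = c" "turn_edge Y c = e"
    by (rule turn_edge_trivalent[OF e True])
  then show ?thesis by simp
next
  case False
  show ?thesis by (simp add: turn_edge_univalent[OF e False])
qed

text \<open>Recovers the cyclic order from \<open>turn_edge\<close>, so that preserving cyclic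
  orders can be traded for commuting with \<open>turn_edge\<close>.\<close>

lemma cyc_iff:
  assumes "card (star1 Y v) = 3" "a \<in> star1 Y v"
  shows "(a, b, c) \<in> cyc Y v \<longleftrightarrow> b = turn_edge Y a \<and> c = turn_edge Y (turn_edge Y a)"
proof -
  have a: "a \<in> edges Y" "card (star1 Y (end1 Y a)) = 3" and v: "v = end1 Y a"
    using assms by (auto simp: star1_iff)
  obtain b' c' where "cyc Y v = {(a, b', c'), (b', c', a), (c', a, b')}" "a \<noteq> b'" "a \<noteq> c'"
    "turn_edge Y a = b'" "turn_edge Y b' = c'"
    unfolding v by (rule turn_edge_trivalent[OF a])
  then show ?thesis by auto
qed

sublocale modular_set "edges Y" "flip_edge Y" "turn_edge Y"
  by unfold_locales (simp_all add: flip_edge_closed flip_edge_flip_edge turn_edge_closed turn_edge_cubed)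

abbreviation edge_act :: "'e \<Rightarrow> (int^2^2) set \<Rightarrow> 'e" where
  "edge_act \<equiv> act (flip_edge Y) (turn_edge Y)"

lemma run_reachable:
  assumes e: "e \<in> edges Y" and e': "e' \<in> edges Y"
  shows "\<exists>w. e' = run (flip_edge Y) (turn_edge Y) w e"
proof -
  define R where "R = {y. \<exists>w. y = run (flip_edge Y) (turn_edge Y) w e}"
  have edge: "y \<in> edges Y" if "y \<in> R" for y using that e by (auto simp: R_def)
  have step: "flip_edge Y y \<in> R" "turn_edge Y y \<in> R" if y: "y \<in> R" for y
  proof -
    obtain w where "y = run (flip_edge Y) (turn_edge Y) w e" using y by (auto simp: R_def)
    then have "flip_edge Y y = run (flip_edge Y) (turn_edge Y) (w @ [False]) e"
      "turn_edge Y y = run (flip_edge Y) (turn_edge Y) (w @ [True]) e" by simp_all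
    then show "flip_edge Y y \<in> R" "turn_edge Y y \<in> R" unfolding R_def by blast+
  qed
  have star: "z \<in> R" if y: "y \<in> R" and z: "z \<in> edges Y" "end0 Y z = end0 Y y \<or> end1 Y z = end1 Y y" for y z
  proof -
    have "z \<in> star0 Y (end0 Y y) \<or> z \<in> star1 Y (end1 Y y)" using z by (auto simp: star0_iff star1_iff)
    then have "z \<in> {y, flip_edge Y y, turn_edge Y y, turn_edge Y (turn_edge Y y)}"
      unfolding star0_end0[OF edge[OF y]] star1_end1[OF edge[OF y]] by auto
    moreover have "{y, flip_edge Y y, turn_edge Y y, turn_edge Y (turn_edge Y y)} \<subseteq> R"
      using step[OF y] step(2)[OF step(2)[OF y]] y by auto
    ultimately show ?thesis by blast
  qed
  have "e \<in> R" unfolding R_def by (intro CollectI exI[of _ "[]"]) simp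
  have "connected_bigraph Y" using cuboid by (simp add: bipartite_cuboid_graph_def)
  moreover have "Inl (end0 Y e) \<in> verts0 Y <+> verts1 Y" "Inl (end0 Y e') \<in> verts0 Y <+> verts1 Y"
    using end_closed e e' by auto
  ultimately have "(Inl (end0 Y e), Inl (end0 Y e')) \<in> (adjacent Y)\<^sup>*"
    unfolding connected_bigraph_def by blast
  \<comment> \<open>The invariant along a path of vertices concerns every edge at the current
    vertex, not just the one travelled. The next adjacency uses some edge at that vertex, which
    therefore lies in R, and \<open>star\<close> spreads membership to all edges at its other
    end.\<close>
  moreover have "\<forall>z\<in>edges Y. q = Inl (end0 Y z) \<or> q = Inr (end1 Y z) \<longrightarrow> z \<in> R"
    if "(Inl (end0 Y e), q) \<in> (adjacent Y)\<^sup>*" for q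
    using that
  proof (induction rule: rtrancl_induct)
    case base
    show ?case using star[OF \<open>e \<in> R\<close>] by auto
  next
    case (step p q)
    from step(2) obtain y where y: "y \<in> edges Y" "p = Inl (end0 Y y) \<or> p = Inr (end1 Y y)"
      "q = Inl (end0 Y y) \<or> q = Inr (end1 Y y)"
      unfolding adjacent_def by blast
    then have "y \<in> R" using step.IH by blast
    show ?case using star[OF \<open>y \<in> R\<close>] y(3) by auto
  qed
  ultimately have "e' \<in> R" using e' by blast
  then show ?thesis by (simp add: R_def)
qed

lemma act_transitive:
  assumes "e \<in> edges Y" "e' \<in> edges Y"
  obtains g where "g \<in> carrier PSL2Z" "edge_act e g = e'"
  using run_reachable[OF assms] act_word_elt[OF assms(1)] word_elt_carrier by metis

end

section \<open>Isomorphisms and automorphisms\<close>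

text \<open>Compatibility with endpoints gives one inclusion; for the other, f is onto the edges and
  injectivity of f0 keeps edges of other vertices away.\<close>

lemma iso_star0:
  assumes "bipartite_cuboid_graph Y" "cuboid_iso Y Z (f, f0, f1)" "v \<in> verts0 Y"
  shows "star0 Z (f0 v) = f ` star0 Y v"
proof -
  interpret cuboid Y by (rule cuboid.intro) fact
  have f: "bij_betw f (edges Y) (edges Z)" and f0: "inj_on f0 (verts0 Y)"
    and ends: "\<And>e. e \<in> edges Y \<Longrightarrow> end0 Z (f e) = f0 (end0 Y e)"
    using assms(2) by (auto simp: bij_betw_def)
  have "end0 Y e = v" if "e \<in> edges Y" "f0 (end0 Y e) = f0 v" for e
    using that inj_onD[OF f0] end_closed assms(3) by blast
  then show ?thesis
    using ends unfolding star0_def bij_betw_imp_surj_on[OF f, symmetric] by auto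
qed

lemma iso_star1:
  assumes "bipartite_cuboid_graph Y" "cuboid_iso Y Z (f, f0, f1)" "v \<in> verts1 Y"
  shows "star1 Z (f1 v) = f ` star1 Y v"
proof -
  interpret cuboid Y by (rule cuboid.intro) fact
  have f: "bij_betw f (edges Y) (edges Z)" and f1: "inj_on f1 (verts1 Y)"
    and ends: "\<And>e. e \<in> edges Y \<Longrightarrow> end1 Z (f e) = f1 (end1 Y e)"
    using assms(2) by (auto simp: bij_betw_def)
  have "end1 Y e = v" if "e \<in> edges Y" "f1 (end1 Y e) = f1 v" for e
    using that inj_onD[OF f1] end_closed assms(3) by blast
  then show ?thesis
    using ends unfolding star1_def bij_betw_imp_surj_on[OF f, symmetric] by auto
qed

lemma iso_card_star1:
  assumes "bipartite_cuboid_graph Y" "cuboid_iso Y Z (f, f0, f1)" "v \<in> verts1 Y"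
  shows "card (star1 Z (f1 v)) = card (star1 Y v)"
proof -
  have "inj_on f (star1 Y v)"
    using assms(2) by (auto simp: bij_betw_def star1_def intro: inj_on_subset)
  then show ?thesis by (simp add: iso_star1[OF assms] card_image)
qed

lemma iso_flip_edge:
  assumes "bipartite_cuboid_graph Y" "cuboid_iso Y Z (f, f0, f1)" "e \<in> edges Y"
  shows "flip_edge Z (f e) = f (flip_edge Y e)"
proof (rule flip_edge_eqI)
  interpret cuboid Y by (rule cuboid.intro) fact
  have "star0 Z (f0 (end0 Y e)) = f ` star0 Y (end0 Y e)"
    using assms end_closed by (intro iso_star0)
  then show "star0 Z (end0 Z (f e)) = {f e, f (flip_edge Y e)}"
    using assms by (simp add: star0_end0)
qed

lemma iso_turn_edge:
  assumes "bipartite_cuboid_graph Y" "bipartite_cuboid_graph Z" "cuboid_iso Y Z (f, f0, f1)" "e \<in> edges Y"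
  shows "turn_edge Z (f e) = f (turn_edge Y e)"
proof -
  interpret Y: cuboid Y by (rule cuboid.intro) fact
  interpret Z: cuboid Z by (rule cuboid.intro) fact
  let ?v = "end1 Y e"
  have v: "?v \<in> verts1 Y" using assms Y.end_closed by blast
  have fe: "f e \<in> edges Z" "end1 Z (f e) = f1 ?v" using assms by (auto simp: bij_betw_def)
  have card: "card (star1 Z (f1 ?v)) = card (star1 Y ?v)" by (rule iso_card_star1) (use assms v in auto)
  show ?thesis
  proof (cases "card (star1 Y ?v) = 3")
    case True
    have mem: "e \<in> star1 Y ?v" "turn_edge Y e \<in> star1 Y ?v" "turn_edge Y (turn_edge Y e) \<in> star1 Y ?v"
      using Y.star1_end1[OF assms(4)] by auto
    then have "(e, turn_edge Y e, turn_edge Y (turn_edge Y e)) \<in> cyc Y ?v"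
      using Y.cyc_iff[OF True] by blast
    \<comment> \<open>The image triple lies in the cyclic order of Z and starts with f e, so
      \<open>cyc_iff\<close> in Z identifies its second entry with the turn of f e.\<close>
    then have "(f e, f (turn_edge Y e), f (turn_edge Y (turn_edge Y e))) \<in> cyc Z (f1 ?v)"
      using assms(3) mem True v by simp
    moreover have "f e \<in> star1 Z (f1 ?v)" using fe by (simp add: star1_iff)
    moreover have "card (star1 Z (f1 ?v)) = 3" using card True by simp
    ultimately show ?thesis using Z.cyc_iff by metis
  next
    case False
    then show ?thesis using card fe by (simp add: turn_edge_def)
  qed
qed

section \<open>Edge stabilisers as isomorphism invariants\<close>

definition edge_stab :: "('e, 'v, 'w) bigraph \<Rightarrow> 'e \<Rightarrow> (int^2^2) set set" where
  "edge_stab Y e = {g \<in> carrier PSL2Z. act (flip_edge Y) (turn_edge Y) e g = e}"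

text \<open>An isomorphism commutes with flips and turns, hence with every word, and
  \<open>act\<close> selects the same word for g in both graphs. Injectivity of f on edges then
  equates the two fixing conditions.\<close>

lemma iso_edge_stab:
  assumes Y: "bipartite_cuboid_graph Y" and Z: "bipartite_cuboid_graph Z"
    and iso: "cuboid_iso Y Z (f, f0, f1)" and e: "e \<in> edges Y"
  shows "edge_stab Z (f e) = edge_stab Y e"
proof -
  interpret Y: cuboid Y by (rule cuboid.intro) fact
  have "run (flip_edge Z) (turn_edge Z) w (f x) = f (run (flip_edge Y) (turn_edge Y) w x)"
    if "x \<in> edges Y" for w x
    using that by (induction w arbitrary: x)
      (simp_all add: iso_flip_edge[OF Y iso] iso_turn_edge[OF Y Z iso])
  then have "act (flip_edge Z) (turn_edge Z) (f e) g = f (Y.edge_act e g)" for g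
    using e by (simp add: act_def)
  moreover have "inj_on f (edges Y)" using iso by (simp add: bij_betw_def)
  ultimately show ?thesis
    unfolding edge_stab_def using e Y.act_closed by (auto dest: inj_onD)
qed

text \<open>Elements of \<open>Bij\<close> are extensional, so units, products and inverses in
  \<open>Aut\<close> are restrictions of the plain maps; this lemma passes between the two.\<close>

lemma cuboid_iso_cong:
  assumes "bipartite_cuboid_graph Y"
    and "\<And>e. e \<in> edges Y \<Longrightarrow> f e = g e" "\<And>v. v \<in> verts0 Y \<Longrightarrow> f0 v = g0 v" "\<And>v. v \<in> verts1 Y \<Longrightarrow> f1 v = g1 v"
    and "cuboid_iso Y Z (f, f0, f1)"
  shows "cuboid_iso Y Z (g, g0, g1)"
proof -
  interpret cuboid Y by (rule cuboid.intro) fact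
  have "bij_betw g (edges Y) (edges Z)" "bij_betw g0 (verts0 Y) (verts0 Z)" "bij_betw g1 (verts1 Y) (verts1 Z)"
    using assms bij_betw_cong[of "edges Y" f g] bij_betw_cong[of "verts0 Y" f0 g0] bij_betw_cong[of "verts1 Y" f1 g1]
    by auto
  moreover have "g a = f a" if "a \<in> star1 Y v" for a v using that assms(2) by (simp add: star1_iff)
  ultimately show ?thesis using assms(2-5) end_closed by simp
qed

lemma cuboid_iso_compose:
  assumes Y: "bipartite_cuboid_graph Y" 
    and f: "cuboid_iso Y Z (f, f0, f1)" and g: "cuboid_iso Z W (g, g0, g1)"
  shows "cuboid_iso Y W (g \<circ> f, g0 \<circ> f0, g1 \<circ> f1)"
proof -
  interpret cuboid Y by (rule cuboid.intro) fact
  have "(a, b, c) \<in> cyc Y v \<longleftrightarrow> (g (f a), g (f b), g (f c)) \<in> cyc W (g1 (f1 v))"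
    if v: "v \<in> verts1 Y" "card (star1 Y v) = 3" and abc: "a \<in> star1 Y v" "b \<in> star1 Y v" "c \<in> star1 Y v" for a b c v
  proof -
    have "f1 v \<in> verts1 Z" using f v by (auto simp: bij_betw_def)
    moreover have "card (star1 Z (f1 v)) = 3" using iso_card_star1[OF Y f v(1)] v(2) by simp
    moreover have "f a \<in> star1 Z (f1 v)" "f b \<in> star1 Z (f1 v)" "f c \<in> star1 Z (f1 v)"
      using iso_star1[OF Y f v(1)] abc by auto
    ultimately show ?thesis using f g v abc by simp
  qed
  moreover have "f e \<in> edges Z" if "e \<in> edges Y" for e using f that by (auto simp: bij_betw_def)
  ultimately show ?thesis using f g by (auto intro: bij_betw_trans)
qed

lemma cuboid_iso_inverse:
  fixes Y :: "('e, 'v, 'w) bigraph" and Z :: "('a, 'b, 'c) bigraph"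
  assumes Y: "bipartite_cuboid_graph Y" and f: "cuboid_iso Y Z (f, f0, f1)"
  shows "cuboid_iso Z Y (inv_into (edges Y) f, inv_into (verts0 Y) f0, inv_into (verts1 Y) f1)"
proof -
  interpret cuboid Y by (rule cuboid.intro) fact
  let ?h = "inv_into (edges Y) f" and ?hv = "inv_into (verts0 Y) f0" and ?hw = "inv_into (verts1 Y) f1"
  have bij: "bij_betw f (edges Y) (edges Z)" "bij_betw f0 (verts0 Y) (verts0 Z)" "bij_betw f1 (verts1 Y) (verts1 Z)"
    and ends: "\<And>e. e \<in> edges Y \<Longrightarrow> end0 Z (f e) = f0 (end0 Y e)" "\<And>e. e \<in> edges Y \<Longrightarrow> end1 Z (f e) = f1 (end1 Y e)"
    using f by auto
  have inv: "?h (f e) = e" if "e \<in> edges Y" for e using that bij by (simp add: bij_betw_def)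
  have inv0: "?hv (f0 v) = v" if "v \<in> verts0 Y" for v using that bij by (simp add: bij_betw_def)
  have inv1: "?hw (f1 v) = v" if "v \<in> verts1 Y" for v using that bij by (simp add: bij_betw_def)
  have "end0 Y (?h e) = ?hv (end0 Z e) \<and> end1 Y (?h e) = ?hw (end1 Z e)" if e: "e \<in> edges Z" for e
  proof -
    obtain d where "d \<in> edges Y" "e = f d" using e bij(1) by (auto simp: bij_betw_def)
    then show ?thesis using ends end_closed inv inv0 inv1 by simp
  qed
  moreover have "(a, b, c) \<in> cyc Z w \<longleftrightarrow> (?h a, ?h b, ?h c) \<in> cyc Y (?hw w)"
    if w: "w \<in> verts1 Z" "card (star1 Z w) = 3" and abc: "a \<in> star1 Z w" "b \<in> star1 Z w" "c \<in> star1 Z w" for a b c w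
  proof -
    obtain v where v: "v \<in> verts1 Y" "w = f1 v" using w bij(3) by (auto simp: bij_betw_def)
    have star: "star1 Z w = f ` star1 Y v" using iso_star1[OF Y f v(1)] v(2) by simp
    obtain a' b' c' where abc': "a' \<in> star1 Y v" "b' \<in> star1 Y v" "c' \<in> star1 Y v" "a = f a'" "b = f b'" "c = f c'"
      using abc unfolding star by blast
    have "card (star1 Y v) = 3" using iso_card_star1[OF Y f v(1)] v(2) w(2) by simp
    then have "(a', b', c') \<in> cyc Y v \<longleftrightarrow> (a, b, c) \<in> cyc Z w"
      using f v abc' by simp
    moreover have "?h a = a'" "?h b = b'" "?h c = c'" "?hw w = v"
      using abc' v inv inv1 by (simp_all add: star1_iff)
    ultimately show ?thesis by simp
  qed
  ultimately show ?thesis using bij by (simp add: bij_betw_inv_into)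
qed

lemma pointed_isomorphic_trans:
  assumes "bipartite_cuboid_graph Y" "pointed_isomorphic (Y, e) (Z, e')" "pointed_isomorphic (Z, e') (W, e'')"
  shows "pointed_isomorphic (Y, e) (W, e'')"
proof -
  obtain f f0 f1 g g0 g1 where fg: "cuboid_iso Y Z (f, f0, f1)" "f e = e'" "cuboid_iso Z W (g, g0, g1)" "g e' = e''"
    using assms(2,3) unfolding pointed_isomorphic.simps by blast
  then have "(g \<circ> f) e = e''" by simp
  then show ?thesis
    unfolding pointed_isomorphic.simps using cuboid_iso_compose[OF assms(1) fg(1,3)] by blast
qed

lemma pointed_isomorphic_sym:
  assumes "bipartite_cuboid_graph Y" "e \<in> edges Y" "pointed_isomorphic (Y, e) (Z, e')"
  shows "pointed_isomorphic (Z, e') (Y, e)"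
proof -
  obtain f f0 f1 where f: "cuboid_iso Y Z (f, f0, f1)" "f e = e'"
    using assms(3) unfolding pointed_isomorphic.simps by blast
  then have "inv_into (edges Y) f e' = e" using assms(2) by (auto simp: bij_betw_def)
  then show ?thesis
    unfolding pointed_isomorphic.simps using cuboid_iso_inverse[OF assms(1) f(1)] by blast
qed

section \<open>The automorphism group and its action on the edges\<close>

lemma Aut_carrier:
  "(f, f0, f1) \<in> carrier (Aut Y) \<longleftrightarrow>
     f \<in> Bij (edges Y) \<and> f0 \<in> Bij (verts0 Y) \<and> f1 \<in> Bij (verts1 Y) \<and> cuboid_iso Y Y (f, f0, f1)"
  by (simp add: Aut_def Let_def BijGroup_def del: cuboid_iso.simps)

lemma group_Aut:
  assumes Y: "bipartite_cuboid_graph Y"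
  shows "group (Aut Y)"
proof -
  define B where "B = BijGroup (edges Y) \<times>\<times> (BijGroup (verts0 Y) \<times>\<times> BijGroup (verts1 Y))"
  interpret B: group B unfolding B_def by (intro DirProd_group group_BijGroup)
  have Bij: "carrier (BijGroup S) = Bij S" for S by (simp add: BijGroup_def)
  let ?H = "{\<phi> \<in> carrier B. cuboid_iso Y Y \<phi>}"
  have "subgroup ?H B"
  proof (rule B.subgroupI)
    have "cuboid_iso Y Y (id, id, id)" by simp
    then have "cuboid_iso Y Y (\<lambda>e\<in>edges Y. e, \<lambda>v\<in>verts0 Y. v, \<lambda>v\<in>verts1 Y. v)"
      by (rule cuboid_iso_cong[OF Y, rotated 3]) simp_all
    then have "cuboid_iso Y Y \<one>\<^bsub>B\<^esub>" by (simp add: B_def BijGroup_def del: cuboid_iso.simps)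
    then show "?H \<noteq> {}" using B.one_closed by blast
  next
    fix \<phi> assume "\<phi> \<in> ?H"
    obtain f f0 f1 where \<phi>: "\<phi> = (f, f0, f1)" by (cases \<phi>)
    have mem: "f \<in> Bij (edges Y)" "f0 \<in> Bij (verts0 Y)" "f1 \<in> Bij (verts1 Y)" and iso: "cuboid_iso Y Y (f, f0, f1)"
      using \<open>\<phi> \<in> ?H\<close> by (simp_all add: \<phi> B_def Bij del: cuboid_iso.simps)
    have "inv\<^bsub>B\<^esub> \<phi> = (\<lambda>e\<in>edges Y. inv_into (edges Y) f e, \<lambda>v\<in>verts0 Y. inv_into (verts0 Y) f0 v,
      \<lambda>v\<in>verts1 Y. inv_into (verts1 Y) f1 v)"
      using mem by (simp add: \<phi> B_def Bij inv_BijGroup group_BijGroup DirProd_group)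
    moreover have "cuboid_iso Y Y (\<lambda>e\<in>edges Y. inv_into (edges Y) f e, \<lambda>v\<in>verts0 Y. inv_into (verts0 Y) f0 v,
      \<lambda>v\<in>verts1 Y. inv_into (verts1 Y) f1 v)"
      by (rule cuboid_iso_cong[OF Y _ _ _ cuboid_iso_inverse[OF Y iso]]) simp_all
    ultimately have "cuboid_iso Y Y (inv\<^bsub>B\<^esub> \<phi>)" by (simp only:)
    then show "inv\<^bsub>B\<^esub> \<phi> \<in> ?H" using \<open>\<phi> \<in> ?H\<close> by blast
  next
    fix \<phi> \<psi> assume "\<phi> \<in> ?H" "\<psi> \<in> ?H"
    obtain f f0 f1 g g0 g1 where \<phi>: "\<phi> = (f, f0, f1)" "\<psi> = (g, g0, g1)" by (cases \<phi>, cases \<psi>)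
    have mem: "f \<in> Bij (edges Y)" "f0 \<in> Bij (verts0 Y)" "f1 \<in> Bij (verts1 Y)"
      "g \<in> Bij (edges Y)" "g0 \<in> Bij (verts0 Y)" "g1 \<in> Bij (verts1 Y)"
      and iso: "cuboid_iso Y Y (f, f0, f1)" "cuboid_iso Y Y (g, g0, g1)"
      using \<open>\<phi> \<in> ?H\<close> \<open>\<psi> \<in> ?H\<close> by (simp_all add: \<phi> B_def Bij del: cuboid_iso.simps)
    have "\<phi> \<otimes>\<^bsub>B\<^esub> \<psi> = (compose (edges Y) f g, compose (verts0 Y) f0 g0, compose (verts1 Y) f1 g1)"
      using mem by (simp add: \<phi> B_def BijGroup_def)
    moreover have "cuboid_iso Y Y (compose (edges Y) f g, compose (verts0 Y) f0 g0, compose (verts1 Y) f1 g1)"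
      by (rule cuboid_iso_cong[OF Y _ _ _ cuboid_iso_compose[OF Y iso(2,1)]]) (simp_all add: compose_def)
    ultimately have "cuboid_iso Y Y (\<phi> \<otimes>\<^bsub>B\<^esub> \<psi>)" by (simp only:)
    then show "\<phi> \<otimes>\<^bsub>B\<^esub> \<psi> \<in> ?H" using \<open>\<phi> \<in> ?H\<close> \<open>\<psi> \<in> ?H\<close> by blast
  qed auto
  then have "group (B\<lparr>carrier := ?H\<rparr>)" by (rule subgroup.subgroup_is_group) (rule B.group_axioms)
  then show ?thesis by (simp add: Aut_def Let_def B_def)
qed

lemma group_action_Aut:
  assumes Y: "bipartite_cuboid_graph Y"
  shows "group_action (Aut Y) (edges Y) fst"
proof (intro group_action.intro group_hom.intro group_hom_axioms.intro group_Aut[OF Y] group_BijGroup homI)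
  show "fst \<phi> \<in> carrier (BijGroup (edges Y))" if "\<phi> \<in> carrier (Aut Y)" for \<phi>
    using that by (cases \<phi>) (auto simp: Aut_carrier BijGroup_def simp del: cuboid_iso.simps)
  show "fst (\<phi> \<otimes>\<^bsub>Aut Y\<^esub> \<psi>) = fst \<phi> \<otimes>\<^bsub>BijGroup (edges Y)\<^esub> fst \<psi>" for \<phi> \<psi>
    by (simp add: Aut_def Let_def mult_DirProd')
qed

lemma pointed_isomorphic_iff_Aut:
  assumes Y: "bipartite_cuboid_graph Y" and "e \<in> edges Y"
  shows "pointed_isomorphic (Y, e) (Y, e') \<longleftrightarrow> (\<exists>\<phi>\<in>carrier (Aut Y). fst \<phi> e = e')"
proof
  assume "pointed_isomorphic (Y, e) (Y, e')"
  then obtain f f0 f1 where f: "cuboid_iso Y Y (f, f0, f1)" "f e = e'"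
    unfolding pointed_isomorphic.simps by blast
  let ?g = "restrict f (edges Y)" and ?gv = "restrict f0 (verts0 Y)" and ?gw = "restrict f1 (verts1 Y)"
  have g: "cuboid_iso Y Y (?g, ?gv, ?gw)"
    by (rule cuboid_iso_cong[OF Y _ _ _ f(1)]) simp_all
  then have "(?g, ?gv, ?gw) \<in> carrier (Aut Y)"
    unfolding Aut_carrier Bij_def by (intro conjI g) (simp_all del: bij_betw_restrict_eq)
  then show "\<exists>\<phi>\<in>carrier (Aut Y). fst \<phi> e = e'"
    by (rule bexI[rotated]) (use f assms in simp)
next
  assume "\<exists>\<phi>\<in>carrier (Aut Y). fst \<phi> e = e'"
  then obtain \<phi> where "\<phi> \<in> carrier (Aut Y)" "fst \<phi> e = e'" by blast
  then show "pointed_isomorphic (Y, e) (Y, e')"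
    unfolding pointed_isomorphic.simps by (cases \<phi>) (auto simp: Aut_carrier simp del: cuboid_iso.simps)
qed

section \<open>The graph of a subgroup\<close>

definition psl_S :: "(int^2^2) set" where "psl_S = word_elt [False]"

lemma psl_S_eq: "psl_class (vector [vector [0, - 1], vector [1, 0]]) = psl_S"
  by (simp add: psl_S_def word_elt_def mS_def M22_def)

lemma u_elt_eq: "u_elt = word_elt [True]"
  by (simp add: u_elt_def word_elt_def mU_def M22_def)

lemma psl_S_closed [simp]: "psl_S \<in> carrier PSL2Z" and u_elt_closed [simp]: "u_elt \<in> carrier PSL2Z"
  by (simp_all add: psl_S_def u_elt_eq word_elt_carrier)

lemma psl_S_squared: "psl_S \<otimes>\<^bsub>PSL2Z\<^esub> psl_S = \<one>\<^bsub>PSL2Z\<^esub>"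
  and u_elt_cubed: "u_elt \<otimes>\<^bsub>PSL2Z\<^esub> (u_elt \<otimes>\<^bsub>PSL2Z\<^esub> u_elt) = \<one>\<^bsub>PSL2Z\<^esub>"
  unfolding psl_S_def u_elt_eq word_elt_append[symmetric]
  by (simp_all add: word_elt_def one_PSL2Z psl_class_eq_iff mS_def mU_def mat_1_M22)

interpretation PSL2Z: group PSL2Z by (rule group_PSL2Z)

lemma G0_eq: "G0 = {\<one>\<^bsub>PSL2Z\<^esub>, psl_S}"
proof -
  have "inv\<^bsub>PSL2Z\<^esub> psl_S = psl_S" by (rule PSL2Z.inv_equality) (simp_all add: psl_S_squared)
  then have "subgroup {\<one>\<^bsub>PSL2Z\<^esub>, psl_S} PSL2Z"
    by (auto simp: subgroup_def psl_S_squared)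
  then have "G0 \<subseteq> {\<one>\<^bsub>PSL2Z\<^esub>, psl_S}"
    unfolding G0_def psl_S_eq by (rule PSL2Z.generate_subgroup_incl[rotated]) simp
  moreover have "\<one>\<^bsub>PSL2Z\<^esub> \<in> G0" "psl_S \<in> G0"
    unfolding G0_def psl_S_eq by (rule generate.one, rule generate.incl, simp)
  ultimately show ?thesis by blast
qed

lemma G1_eq: "G1 = {\<one>\<^bsub>PSL2Z\<^esub>, u_elt, u_elt \<otimes>\<^bsub>PSL2Z\<^esub> u_elt}"
proof -
  have cubed: "(u_elt \<otimes>\<^bsub>PSL2Z\<^esub> u_elt) \<otimes>\<^bsub>PSL2Z\<^esub> u_elt = \<one>\<^bsub>PSL2Z\<^esub>"
    using u_elt_cubed by (simp add: PSL2Z.m_assoc)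
  have fourth: "u_elt \<otimes>\<^bsub>PSL2Z\<^esub> u_elt \<otimes>\<^bsub>PSL2Z\<^esub> (u_elt \<otimes>\<^bsub>PSL2Z\<^esub> u_elt) = u_elt"
    using cubed by (simp flip: PSL2Z.m_assoc)
  have "inv\<^bsub>PSL2Z\<^esub> u_elt = u_elt \<otimes>\<^bsub>PSL2Z\<^esub> u_elt"
    by (rule PSL2Z.inv_equality) (simp_all add: cubed)
  moreover have "inv\<^bsub>PSL2Z\<^esub> (u_elt \<otimes>\<^bsub>PSL2Z\<^esub> u_elt) = u_elt"
    by (rule PSL2Z.inv_equality) (simp_all add: u_elt_cubed)
  ultimately have "subgroup {\<one>\<^bsub>PSL2Z\<^esub>, u_elt, u_elt \<otimes>\<^bsub>PSL2Z\<^esub> u_elt} PSL2Z"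
    by (auto simp: subgroup_def u_elt_cubed cubed fourth)
  then have "G1 \<subseteq> {\<one>\<^bsub>PSL2Z\<^esub>, u_elt, u_elt \<otimes>\<^bsub>PSL2Z\<^esub> u_elt}"
    unfolding G1_def by (rule PSL2Z.generate_subgroup_incl[rotated]) simp
  moreover have "\<one>\<^bsub>PSL2Z\<^esub> \<in> G1" "u_elt \<in> G1"
    unfolding G1_def by (rule generate.one, rule generate.incl, simp)
  moreover from this have "u_elt \<otimes>\<^bsub>PSL2Z\<^esub> u_elt \<in> G1"
    unfolding G1_def by (blast intro: generate.eng)
  ultimately show ?thesis by blast
qed

lemma right_orbit_eq_image: "right_orbit H C = (\<lambda>g. C #>\<^bsub>PSL2Z\<^esub> g) ` H"
  by (auto simp: right_orbit_def)

lemma right_orbit_G0: "C \<subseteq> carrier PSL2Z \<Longrightarrow> right_orbit G0 C = {C, C #>\<^bsub>PSL2Z\<^esub> psl_S}"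
  by (simp add: right_orbit_eq_image G0_eq)

lemma right_orbit_G1:
  "C \<subseteq> carrier PSL2Z \<Longrightarrow> right_orbit G1 C = {C, C #>\<^bsub>PSL2Z\<^esub> u_elt, C #>\<^bsub>PSL2Z\<^esub> u_elt #>\<^bsub>PSL2Z\<^esub> u_elt}"
  by (simp add: right_orbit_eq_image G1_eq PSL2Z.coset_mult_assoc)

lemma Y_comb_simps [simp]:
  "edges (Y_comb G) = rcosets\<^bsub>PSL2Z\<^esub> G"
  "verts0 (Y_comb G) = right_orbit G0 ` (rcosets\<^bsub>PSL2Z\<^esub> G)"
  "verts1 (Y_comb G) = right_orbit G1 ` (rcosets\<^bsub>PSL2Z\<^esub> G)"
  "end0 (Y_comb G) = right_orbit G0"
  "end1 (Y_comb G) = right_orbit G1"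
  "cyc (Y_comb G) v = {(x, x #>\<^bsub>PSL2Z\<^esub> u_elt, x #>\<^bsub>PSL2Z\<^esub> u_elt #>\<^bsub>PSL2Z\<^esub> u_elt) | x. x \<in> v}"
  by (simp_all add: Y_comb_def)

lemma cyclic_order_on_3:
  assumes "a \<noteq> b" "b \<noteq> c" "a \<noteq> c"
  shows "cyclic_order_on {a, b, c} {(a, b, c), (b, c, a), (c, a, b)}"
  using assms unfolding cyclic_order_on_def by auto

section \<open>The coset graph is a cuboid graph\<close>

locale psl_subgroup =
  fixes G assumes subgroup: "subgroup G PSL2Z"
begin

lemma G_subset: "G \<subseteq> carrier PSL2Z"
  using subgroup by (rule subgroup.subset)

lemma rcosets_subset: "C \<in> rcosets\<^bsub>PSL2Z\<^esub> G \<Longrightarrow> C \<subseteq> carrier PSL2Z"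
  using subgroup.rcosets_carrier[OF subgroup PSL2Z.is_group] .

lemma rcosets_mult: "C \<in> rcosets\<^bsub>PSL2Z\<^esub> G \<Longrightarrow> g \<in> carrier PSL2Z \<Longrightarrow> C #>\<^bsub>PSL2Z\<^esub> g \<in> rcosets\<^bsub>PSL2Z\<^esub> G"
  by (auto simp: RCOSETS_def PSL2Z.coset_mult_assoc G_subset)

lemma coset_S_S: "C \<in> rcosets\<^bsub>PSL2Z\<^esub> G \<Longrightarrow> C #>\<^bsub>PSL2Z\<^esub> psl_S #>\<^bsub>PSL2Z\<^esub> psl_S = C"
  by (simp add: PSL2Z.coset_mult_assoc psl_S_squared rcosets_subset)

lemma coset_U_U_U: "C \<in> rcosets\<^bsub>PSL2Z\<^esub> G \<Longrightarrow>
    C #>\<^bsub>PSL2Z\<^esub> u_elt #>\<^bsub>PSL2Z\<^esub> u_elt #>\<^bsub>PSL2Z\<^esub> u_elt = C"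
  by (simp add: PSL2Z.coset_mult_assoc PSL2Z.m_assoc u_elt_cubed rcosets_subset)

lemma end0_Y_comb: "C \<in> rcosets\<^bsub>PSL2Z\<^esub> G \<Longrightarrow> right_orbit G0 C = {C, C #>\<^bsub>PSL2Z\<^esub> psl_S}"
  by (rule right_orbit_G0) (rule rcosets_subset)

lemma end1_Y_comb: "C \<in> rcosets\<^bsub>PSL2Z\<^esub> G \<Longrightarrow>
    right_orbit G1 C = {C, C #>\<^bsub>PSL2Z\<^esub> u_elt, C #>\<^bsub>PSL2Z\<^esub> u_elt #>\<^bsub>PSL2Z\<^esub> u_elt}"
  by (rule right_orbit_G1) (rule rcosets_subset)

lemma right_orbit_S: "C \<in> rcosets\<^bsub>PSL2Z\<^esub> G \<Longrightarrow> right_orbit G0 (C #>\<^bsub>PSL2Z\<^esub> psl_S) = right_orbit G0 C"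
  by (simp add: end0_Y_comb rcosets_mult coset_S_S insert_commute)

lemma right_orbit_U: "C \<in> rcosets\<^bsub>PSL2Z\<^esub> G \<Longrightarrow> right_orbit G1 (C #>\<^bsub>PSL2Z\<^esub> u_elt) = right_orbit G1 C"
  by (simp add: end1_Y_comb rcosets_mult coset_U_U_U) blast

lemma star0_Y_comb:
  assumes C: "C \<in> rcosets\<^bsub>PSL2Z\<^esub> G"
  shows "star0 (Y_comb G) (right_orbit G0 C) = {C, C #>\<^bsub>PSL2Z\<^esub> psl_S}"
proof -
  have "D \<in> {C, C #>\<^bsub>PSL2Z\<^esub> psl_S}" if "D \<in> rcosets\<^bsub>PSL2Z\<^esub> G" "right_orbit G0 D = right_orbit G0 C" for D
    using that end0_Y_comb[OF C] end0_Y_comb[of D] by blast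
  then show ?thesis
    unfolding star0_def using C rcosets_mult[OF C] right_orbit_S[OF C] by auto
qed

text \<open>A vertex of type (1) is an orbit, hence literally the set of its own edges. This is why
  \<open>cyc\<close> may let x range over the vertex itself.\<close>

lemma star1_Y_comb:
  assumes C: "C \<in> rcosets\<^bsub>PSL2Z\<^esub> G"
  shows "star1 (Y_comb G) (right_orbit G1 C) = right_orbit G1 C"
proof -
  have "D \<in> right_orbit G1 C" if "D \<in> rcosets\<^bsub>PSL2Z\<^esub> G" "right_orbit G1 D = right_orbit G1 C" for D
    using that end1_Y_comb[of D] by blast
  moreover have "C #>\<^bsub>PSL2Z\<^esub> u_elt \<in> rcosets\<^bsub>PSL2Z\<^esub> G"
    "C #>\<^bsub>PSL2Z\<^esub> u_elt #>\<^bsub>PSL2Z\<^esub> u_elt \<in> rcosets\<^bsub>PSL2Z\<^esub> G"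
    using C by (simp_all add: rcosets_mult)
  moreover have "right_orbit G1 (C #>\<^bsub>PSL2Z\<^esub> u_elt) = right_orbit G1 C"
    "right_orbit G1 (C #>\<^bsub>PSL2Z\<^esub> u_elt #>\<^bsub>PSL2Z\<^esub> u_elt) = right_orbit G1 C"
    using C by (simp_all add: rcosets_mult right_orbit_U)
  ultimately have "D \<in> star1 (Y_comb G) (right_orbit G1 C) \<longleftrightarrow> D \<in> right_orbit G1 C" for D
    unfolding star1_iff using C end1_Y_comb[OF C] by auto
  then show ?thesis by blast
qed

lemma star1_Y_comb_eq: "C \<in> rcosets\<^bsub>PSL2Z\<^esub> G \<Longrightarrow> star1 (Y_comb G) (right_orbit G1 C) =
    {C, C #>\<^bsub>PSL2Z\<^esub> u_elt, C #>\<^bsub>PSL2Z\<^esub> u_elt #>\<^bsub>PSL2Z\<^esub> u_elt}"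
  by (rule trans[OF star1_Y_comb end1_Y_comb])

text \<open>Translation by u has order dividing 3, so any coincidence among the three translates
  makes C a fixed point. This yields the valencies 1 and 3.\<close>

lemma coset_U_cases:
  assumes C: "C \<in> rcosets\<^bsub>PSL2Z\<^esub> G"
  obtains "C #>\<^bsub>PSL2Z\<^esub> u_elt = C" 
  | "distinct [C, C #>\<^bsub>PSL2Z\<^esub> u_elt, C #>\<^bsub>PSL2Z\<^esub> u_elt #>\<^bsub>PSL2Z\<^esub> u_elt]"
proof -
  have "C #>\<^bsub>PSL2Z\<^esub> u_elt = C" if "C = C #>\<^bsub>PSL2Z\<^esub> u_elt #>\<^bsub>PSL2Z\<^esub> u_elt"
    using coset_U_U_U[OF C] that by simp
  moreover have "C #>\<^bsub>PSL2Z\<^esub> u_elt = C" if "C #>\<^bsub>PSL2Z\<^esub> u_elt = C #>\<^bsub>PSL2Z\<^esub> u_elt #>\<^bsub>PSL2Z\<^esub> u_elt"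
    using coset_U_U_U[OF C] that by simp
  ultimately show ?thesis using that by (metis distinct_length_2_or_more distinct_singleton)
qed

lemma connected_Y_comb: "connected_bigraph (Y_comb G)"
proof -
  let ?A = "(adjacent (Y_comb G))\<^sup>*"
  have adj: "(Inl (right_orbit G0 C), Inr (right_orbit G1 C)) \<in> ?A" "(Inr (right_orbit G1 C), Inl (right_orbit G0 C)) \<in> ?A"
    if "C \<in> rcosets\<^bsub>PSL2Z\<^esub> G" for C
    using that by (auto simp: adjacent_def intro!: r_into_rtrancl)
  \<comment> \<open>A letter S keeps the vertex of type (0), and a letter U passes to another edge
    at the same vertex of type (1). Surjectivity of words then joins any two cosets.\<close>
  have word: "(Inl (right_orbit G0 C), Inl (right_orbit G0 (C #>\<^bsub>PSL2Z\<^esub> word_elt w))) \<in> ?A"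
    if "C \<in> rcosets\<^bsub>PSL2Z\<^esub> G" for C w
    using that
  proof (induction w arbitrary: C)
    case Nil
    then show ?case by (simp add: word_elt_Nil rcosets_subset)
  next
    case (Cons b w)
    let ?C = "C #>\<^bsub>PSL2Z\<^esub> word_elt [b]"
    have C': "?C \<in> rcosets\<^bsub>PSL2Z\<^esub> G" using Cons.prems by (simp add: rcosets_mult word_elt_carrier)
    have "word_elt (b # w) = word_elt [b] \<otimes>\<^bsub>PSL2Z\<^esub> word_elt w"
      using word_elt_append[of "[b]" w] by simp
    then have "C #>\<^bsub>PSL2Z\<^esub> word_elt (b # w) = ?C #>\<^bsub>PSL2Z\<^esub> word_elt w"
      using Cons.prems by (simp add: PSL2Z.coset_mult_assoc rcosets_subset word_elt_carrier)
    moreover have "(Inl (right_orbit G0 C), Inl (right_orbit G0 ?C)) \<in> ?A"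
    proof (cases b)
      case True
      then have "right_orbit G1 ?C = right_orbit G1 C"
        using right_orbit_U[OF Cons.prems] by (simp add: u_elt_eq)
      then show ?thesis using adj(1)[OF Cons.prems] adj(2)[OF C'] by (simp add: rtrancl_trans)
    next
      case False
      then show ?thesis using right_orbit_S[OF Cons.prems] by (simp add: psl_S_def)
    qed
    ultimately show ?case using Cons.IH[OF C'] by (simp add: rtrancl_trans)
  qed
  have edges: "(Inl (right_orbit G0 C), Inl (right_orbit G0 D)) \<in> ?A"
    if C: "C \<in> rcosets\<^bsub>PSL2Z\<^esub> G" and D: "D \<in> rcosets\<^bsub>PSL2Z\<^esub> G" for C D
  proof -
    obtain x y where x: "x \<in> carrier PSL2Z" "C = G #>\<^bsub>PSL2Z\<^esub> x" and y: "y \<in> carrier PSL2Z" "D = G #>\<^bsub>PSL2Z\<^esub> y"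
      using C D by (auto simp: RCOSETS_def)
    have "inv\<^bsub>PSL2Z\<^esub> x \<otimes>\<^bsub>PSL2Z\<^esub> y \<in> carrier PSL2Z" using x y by simp
    then obtain w where w: "inv\<^bsub>PSL2Z\<^esub> x \<otimes>\<^bsub>PSL2Z\<^esub> y = word_elt w" by (rule word_elt_surj)
    have "C #>\<^bsub>PSL2Z\<^esub> word_elt w = D"
      unfolding w[symmetric] x(2) y(2) using x y G_subset
      by (simp add: PSL2Z.coset_mult_assoc flip: PSL2Z.m_assoc)
    then show ?thesis using word[OF C, of w] by simp
  qed
  have vert: "\<exists>C\<in>rcosets\<^bsub>PSL2Z\<^esub> G. (p, Inl (right_orbit G0 C)) \<in> ?A \<and> (Inl (right_orbit G0 C), p) \<in> ?A"
    if "p \<in> verts0 (Y_comb G) <+> verts1 (Y_comb G)" for p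
    using that adj by auto
  show ?thesis
    unfolding connected_bigraph_def by (meson vert edges rtrancl_trans)
qed

lemma cuboid_Y_comb: "bipartite_cuboid_graph (Y_comb G)"
proof -
  have card0: "card (star0 (Y_comb G) (right_orbit G0 C)) \<in> {1, 2}" if "C \<in> rcosets\<^bsub>PSL2Z\<^esub> G" for C
    by (simp add: star0_Y_comb[OF that] card_insert_if)
  have card1: "card (star1 (Y_comb G) (right_orbit G1 C)) \<in> {1, 3}" if "C \<in> rcosets\<^bsub>PSL2Z\<^esub> G" for C
    using that unfolding star1_Y_comb_eq[OF that] by (rule coset_U_cases) simp_all
  have cyc: "cyclic_order_on (star1 (Y_comb G) (right_orbit G1 C)) (cyc (Y_comb G) (right_orbit G1 C))"
    if C: "C \<in> rcosets\<^bsub>PSL2Z\<^esub> G" and 3: "card (star1 (Y_comb G) (right_orbit G1 C)) = 3" for C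
  proof -
    define a b c where "a = C" "b = C #>\<^bsub>PSL2Z\<^esub> u_elt" "c = C #>\<^bsub>PSL2Z\<^esub> u_elt #>\<^bsub>PSL2Z\<^esub> u_elt"
    note abc = this
    have "a \<noteq> b" "b \<noteq> c" "a \<noteq> c"
      using C by (rule coset_U_cases; use 3[unfolded star1_Y_comb_eq[OF C]] in \<open>simp add: abc\<close>)+
    moreover have "right_orbit G1 C = {a, b, c}" using end1_Y_comb[OF C] by (simp add: abc)
    \<comment> \<open>Translation by u permutes a, b, c cyclically, so the triples (x, xu, xu^2) are
      the three rotations of (a, b, c).\<close>
    moreover have "a #>\<^bsub>PSL2Z\<^esub> u_elt = b" "b #>\<^bsub>PSL2Z\<^esub> u_elt = c" "c #>\<^bsub>PSL2Z\<^esub> u_elt = a"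
      using coset_U_U_U[OF C] by (simp_all add: abc)
    ultimately show ?thesis
      unfolding star1_Y_comb[OF C] Y_comb_simps Setcompr_eq_image
      by (simp add: cyclic_order_on_3)
  qed
  show ?thesis
    unfolding bipartite_cuboid_graph_def using card0 card1 cyc connected_Y_comb
    by (simp del: Y_comb_simps(6))
qed

sublocale cuboid "Y_comb G"
  by unfold_locales (rule cuboid_Y_comb)

lemma flip_edge_Y_comb: "C \<in> rcosets\<^bsub>PSL2Z\<^esub> G \<Longrightarrow> flip_edge (Y_comb G) C = C #>\<^bsub>PSL2Z\<^esub> psl_S"
  by (rule flip_edge_eqI) (simp add: star0_Y_comb)

lemma turn_edge_Y_comb:
  assumes C: "C \<in> rcosets\<^bsub>PSL2Z\<^esub> G"
  shows "turn_edge (Y_comb G) C = C #>\<^bsub>PSL2Z\<^esub> u_elt"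
  using C
proof (rule coset_U_cases)
  assume "C #>\<^bsub>PSL2Z\<^esub> u_elt = C"
  then show ?thesis
    by (simp add: turn_edge_def star1_Y_comb_eq[OF C])
next
  assume "distinct [C, C #>\<^bsub>PSL2Z\<^esub> u_elt, C #>\<^bsub>PSL2Z\<^esub> u_elt #>\<^bsub>PSL2Z\<^esub> u_elt]"
  then have "card (star1 (Y_comb G) (right_orbit G1 C)) = 3"
    unfolding star1_Y_comb_eq[OF C] by simp
  moreover have C': "C \<in> right_orbit G1 C" by (simp add: end1_Y_comb[OF C])
  moreover have "(C, C #>\<^bsub>PSL2Z\<^esub> u_elt, C #>\<^bsub>PSL2Z\<^esub> u_elt #>\<^bsub>PSL2Z\<^esub> u_elt) \<in> cyc (Y_comb G) (right_orbit G1 C)"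
    using C' by auto
  ultimately show ?thesis using cyc_iff star1_Y_comb[OF C] by metis
qed

text \<open>The action rebuilt from the graph structure is the right translation that the graph came
  from, so stabilisers can be computed with cosets.\<close>

lemma act_Y_comb:
  assumes "C \<in> rcosets\<^bsub>PSL2Z\<^esub> G" "g \<in> carrier PSL2Z"
  shows "edge_act C g = C #>\<^bsub>PSL2Z\<^esub> g"
proof -
  have run: "run (flip_edge (Y_comb G)) (turn_edge (Y_comb G)) w C = C #>\<^bsub>PSL2Z\<^esub> word_elt w"
    if "C \<in> rcosets\<^bsub>PSL2Z\<^esub> G" for w C
    using that
  proof (induction w arbitrary: C)
    case Nil
    then show ?case by (simp add: word_elt_Nil rcosets_subset)
  next
    case (Cons b w)
    have "word_elt (b # w) = word_elt [b] \<otimes>\<^bsub>PSL2Z\<^esub> word_elt w"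
      using word_elt_append[of "[b]" w] by simp
    then have "C #>\<^bsub>PSL2Z\<^esub> word_elt (b # w) = C #>\<^bsub>PSL2Z\<^esub> word_elt [b] #>\<^bsub>PSL2Z\<^esub> word_elt w"
      using Cons.prems by (simp add: PSL2Z.coset_mult_assoc rcosets_subset word_elt_carrier)
    moreover have "(if b then turn_edge (Y_comb G) C else flip_edge (Y_comb G) C) = C #>\<^bsub>PSL2Z\<^esub> word_elt [b]"
      using Cons.prems by (simp add: turn_edge_Y_comb flip_edge_Y_comb u_elt_eq psl_S_def)
    ultimately show ?case
      using Cons.IH[OF rcosets_mult[OF Cons.prems word_elt_carrier]] by simp
  qed
  obtain w where "g = word_elt w" using assms(2) by (rule word_elt_surj)
  then show ?thesis using run assms(1) act_word_elt by simp
qed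

lemma edge_stab_Y_comb:
  assumes x: "x \<in> carrier PSL2Z"
  shows "edge_stab (Y_comb G) (G #>\<^bsub>PSL2Z\<^esub> x) = inv\<^bsub>PSL2Z\<^esub> x <#\<^bsub>PSL2Z\<^esub> G #>\<^bsub>PSL2Z\<^esub> x"
proof -
  have Gx: "G #>\<^bsub>PSL2Z\<^esub> x \<in> rcosets\<^bsub>PSL2Z\<^esub> G" using x G_subset by (intro PSL2Z.rcosetsI)
  have "G #>\<^bsub>PSL2Z\<^esub> x #>\<^bsub>PSL2Z\<^esub> g = G #>\<^bsub>PSL2Z\<^esub> x \<longleftrightarrow> x \<otimes>\<^bsub>PSL2Z\<^esub> g \<otimes>\<^bsub>PSL2Z\<^esub> inv\<^bsub>PSL2Z\<^esub> x \<in> G"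
    if g: "g \<in> carrier PSL2Z" for g
  proof -
    have "G #>\<^bsub>PSL2Z\<^esub> x #>\<^bsub>PSL2Z\<^esub> g = G #>\<^bsub>PSL2Z\<^esub> x \<longleftrightarrow> G #>\<^bsub>PSL2Z\<^esub> (x \<otimes>\<^bsub>PSL2Z\<^esub> g) = G #>\<^bsub>PSL2Z\<^esub> x"
      using x g G_subset by (simp add: PSL2Z.coset_mult_assoc)
    also have "\<dots> \<longleftrightarrow> x \<otimes>\<^bsub>PSL2Z\<^esub> g \<in> G #>\<^bsub>PSL2Z\<^esub> x"
      using x g subgroup PSL2Z.repr_independence PSL2Z.repr_independenceD PSL2Z.m_closed by metis
    also have "\<dots> \<longleftrightarrow> x \<otimes>\<^bsub>PSL2Z\<^esub> g \<otimes>\<^bsub>PSL2Z\<^esub> inv\<^bsub>PSL2Z\<^esub> x \<in> G"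
      using subgroup.rcos_module[OF subgroup PSL2Z.is_group] x g by simp
    finally show ?thesis .
  qed
  then have "edge_stab (Y_comb G) (G #>\<^bsub>PSL2Z\<^esub> x) =
      {g \<in> carrier PSL2Z. x \<otimes>\<^bsub>PSL2Z\<^esub> g \<otimes>\<^bsub>PSL2Z\<^esub> inv\<^bsub>PSL2Z\<^esub> x \<in> G}"
    unfolding edge_stab_def using act_Y_comb[OF Gx] by auto
  also have "\<dots> = inv\<^bsub>PSL2Z\<^esub> x <#\<^bsub>PSL2Z\<^esub> G #>\<^bsub>PSL2Z\<^esub> x"
  proof (intro equalityI subsetI)
    fix g assume "g \<in> {g \<in> carrier PSL2Z. x \<otimes>\<^bsub>PSL2Z\<^esub> g \<otimes>\<^bsub>PSL2Z\<^esub> inv\<^bsub>PSL2Z\<^esub> x \<in> G}"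
    then have g: "g \<in> carrier PSL2Z" "x \<otimes>\<^bsub>PSL2Z\<^esub> g \<otimes>\<^bsub>PSL2Z\<^esub> inv\<^bsub>PSL2Z\<^esub> x \<in> G" by auto
    have "g = inv\<^bsub>PSL2Z\<^esub> x \<otimes>\<^bsub>PSL2Z\<^esub> (x \<otimes>\<^bsub>PSL2Z\<^esub> g \<otimes>\<^bsub>PSL2Z\<^esub> inv\<^bsub>PSL2Z\<^esub> x) \<otimes>\<^bsub>PSL2Z\<^esub> x"
      using x g(1) by (simp add: PSL2Z.m_assoc) (simp flip: PSL2Z.m_assoc)
    then show "g \<in> inv\<^bsub>PSL2Z\<^esub> x <#\<^bsub>PSL2Z\<^esub> G #>\<^bsub>PSL2Z\<^esub> x"
      using g(2) unfolding l_coset_def r_coset_def by blast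
  next
    fix g assume "g \<in> inv\<^bsub>PSL2Z\<^esub> x <#\<^bsub>PSL2Z\<^esub> G #>\<^bsub>PSL2Z\<^esub> x"
    then obtain h where h: "h \<in> G" "g = inv\<^bsub>PSL2Z\<^esub> x \<otimes>\<^bsub>PSL2Z\<^esub> h \<otimes>\<^bsub>PSL2Z\<^esub> x"
      unfolding l_coset_def r_coset_def by blast
    then have "h \<in> carrier PSL2Z" using G_subset by blast
    then have "x \<otimes>\<^bsub>PSL2Z\<^esub> g \<otimes>\<^bsub>PSL2Z\<^esub> inv\<^bsub>PSL2Z\<^esub> x = h"
      using x by (simp add: h(2) PSL2Z.m_assoc) (simp flip: PSL2Z.m_assoc)
    then show "g \<in> {g \<in> carrier PSL2Z. x \<otimes>\<^bsub>PSL2Z\<^esub> g \<otimes>\<^bsub>PSL2Z\<^esub> inv\<^bsub>PSL2Z\<^esub> x \<in> G}"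
      using h x \<open>h \<in> carrier PSL2Z\<close> by simp
  qed
  finally show ?thesis .
qed

lemma edge_stab_base_edge: "edge_stab (Y_comb G) G = G"
  using edge_stab_Y_comb[OF PSL2Z.one_closed] G_subset by (simp add: PSL2Z.lcos_mult_one)

lemma base_edge_in_edges: "G \<in> rcosets\<^bsub>PSL2Z\<^esub> G"
  using PSL2Z.rcosetsI[OF G_subset PSL2Z.one_closed] G_subset by simp

end

section \<open>Classification by stabilisers\<close>

context cuboid
begin

lemma flip_edge_eq_act: "e \<in> edges Y \<Longrightarrow> flip_edge Y e = edge_act e psl_S"
  and turn_edge_eq_act: "e \<in> edges Y \<Longrightarrow> turn_edge Y e = edge_act e u_elt"
  by (simp_all add: psl_S_def u_elt_eq act_word_elt)

lemma subgroup_edge_stab: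
  assumes e: "e \<in> edges Y"
  shows "subgroup (edge_stab Y e) PSL2Z"
proof
  show "inv\<^bsub>PSL2Z\<^esub> g \<in> edge_stab Y e" if "g \<in> edge_stab Y e" for g
  proof -
    have g: "g \<in> carrier PSL2Z" "edge_act e g = e" using that by (auto simp: edge_stab_def)
    then have "edge_act e (inv\<^bsub>PSL2Z\<^esub> g) = edge_act e (g \<otimes>\<^bsub>PSL2Z\<^esub> inv\<^bsub>PSL2Z\<^esub> g)"
      using act_mult[OF e g(1) PSL2Z.inv_closed[OF g(1)]] by (simp only:)
    then show ?thesis using g e by (simp add: edge_stab_def act_one)
  qed
qed (auto simp: edge_stab_def act_one act_mult e)

lemma pointed_isomorphic_Y_comb:
  assumes e: "e \<in> edges Y"
  shows "pointed_isomorphic (Y, e) (pointed_Y_comb (edge_stab Y e))"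
proof -
  define H where "H = edge_stab Y e"
  interpret H: psl_subgroup H
    unfolding H_def by (rule psl_subgroup.intro[OF subgroup_edge_stab[OF e]])
  \<comment> \<open>The edge y corresponds to the coset of all elements that carry e to y, so no
    representative has to be chosen.\<close>
  define f where "f y = {g \<in> carrier PSL2Z. edge_act e g = y}" for y
  have f_act: "f (edge_act e x) = H #>\<^bsub>PSL2Z\<^esub> x" if x: "x \<in> carrier PSL2Z" for x
  proof -
    have "edge_act e g = edge_act e x \<longleftrightarrow> g \<in> H #>\<^bsub>PSL2Z\<^esub> x" if g: "g \<in> carrier PSL2Z" for g
    proof -
      have "edge_act e g = edge_act e x \<longleftrightarrow> edge_act e (g \<otimes>\<^bsub>PSL2Z\<^esub> inv\<^bsub>PSL2Z\<^esub> x) = e"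
      proof
        assume "edge_act e g = edge_act e x"
        then have "edge_act e (g \<otimes>\<^bsub>PSL2Z\<^esub> inv\<^bsub>PSL2Z\<^esub> x) = edge_act e (x \<otimes>\<^bsub>PSL2Z\<^esub> inv\<^bsub>PSL2Z\<^esub> x)"
          using act_mult[OF e g PSL2Z.inv_closed[OF x]] act_mult[OF e x PSL2Z.inv_closed[OF x]]
          by (simp only:)
        then show "edge_act e (g \<otimes>\<^bsub>PSL2Z\<^esub> inv\<^bsub>PSL2Z\<^esub> x) = e" using x e by (simp add: act_one)
      next
        assume "edge_act e (g \<otimes>\<^bsub>PSL2Z\<^esub> inv\<^bsub>PSL2Z\<^esub> x) = e"
        then have "edge_act e (g \<otimes>\<^bsub>PSL2Z\<^esub> inv\<^bsub>PSL2Z\<^esub> x \<otimes>\<^bsub>PSL2Z\<^esub> x) = edge_act e x"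
          using x g e act_mult[OF e, of "g \<otimes>\<^bsub>PSL2Z\<^esub> inv\<^bsub>PSL2Z\<^esub> x" x] by simp
        then show "edge_act e g = edge_act e x" using x g by (simp add: PSL2Z.m_assoc)
      qed
      also have "\<dots> \<longleftrightarrow> g \<otimes>\<^bsub>PSL2Z\<^esub> inv\<^bsub>PSL2Z\<^esub> x \<in> H" using x g by (simp add: H_def edge_stab_def)
      also have "\<dots> \<longleftrightarrow> g \<in> H #>\<^bsub>PSL2Z\<^esub> x"
        using subgroup.rcos_module[OF H.subgroup PSL2Z.is_group] x g by simp
      finally show ?thesis .
    qed
    moreover have "H #>\<^bsub>PSL2Z\<^esub> x \<subseteq> carrier PSL2Z"
      using x H.G_subset by (rule PSL2Z.r_coset_subset_G[rotated])
    ultimately show ?thesis unfolding f_def by blast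
  qed
  have f_mult: "f (edge_act y g) = f y #>\<^bsub>PSL2Z\<^esub> g" if y: "y \<in> edges Y" and g: "g \<in> carrier PSL2Z" for y g
  proof -
    obtain x where x: "x \<in> carrier PSL2Z" "edge_act e x = y" using act_transitive[OF e y] .
    have "f (edge_act y g) = f (edge_act e (x \<otimes>\<^bsub>PSL2Z\<^esub> g))" using x g e by (simp add: act_mult)
    also have "\<dots> = f y #>\<^bsub>PSL2Z\<^esub> g"
      using x g f_act[of x] f_act[of "x \<otimes>\<^bsub>PSL2Z\<^esub> g"] H.G_subset by (simp add: PSL2Z.coset_mult_assoc)
    finally show ?thesis .
  qed
  \<comment> \<open>By transitivity f y is nonempty, and any of its elements determines y as the
    image of e.\<close>
  have inj: "inj_on f (edges Y)"
  proof (rule inj_onI)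
    fix y z assume "y \<in> edges Y" "f y = f z"
    obtain x where "x \<in> carrier PSL2Z" "edge_act e x = y" using act_transitive[OF e \<open>y \<in> edges Y\<close>] .
    then have "x \<in> f z" unfolding \<open>f y = f z\<close>[symmetric] by (simp add: f_def)
    then show "y = z" using \<open>edge_act e x = y\<close> by (simp add: f_def)
  qed
  have surj: "f ` edges Y = rcosets\<^bsub>PSL2Z\<^esub> H"
  proof (intro equalityI subsetI)
    fix C assume "C \<in> f ` edges Y"
    then obtain y where y: "y \<in> edges Y" "C = f y" by blast
    obtain x where "x \<in> carrier PSL2Z" "edge_act e x = y" using act_transitive[OF e y(1)] .
    then show "C \<in> rcosets\<^bsub>PSL2Z\<^esub> H" using f_act y(2) by (auto simp: RCOSETS_def)
  next
    fix C assume "C \<in> rcosets\<^bsub>PSL2Z\<^esub> H"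
    then obtain x where "x \<in> carrier PSL2Z" "C = H #>\<^bsub>PSL2Z\<^esub> x" by (auto simp: RCOSETS_def)
    then show "C \<in> f ` edges Y" using f_act act_closed[OF e] by blast
  qed
  have f_closed: "f y \<in> rcosets\<^bsub>PSL2Z\<^esub> H" if "y \<in> edges Y" for y using surj that by blast
  have f_turn: "f (turn_edge Y y) = f y #>\<^bsub>PSL2Z\<^esub> u_elt" if "y \<in> edges Y" for y
    using that by (simp add: turn_edge_eq_act f_mult)
  \<comment> \<open>Vertices of the coset graph are orbits, that is, sets of cosets. A vertex of Y
    therefore has to be sent to the image under f of its star, and this checks that endpoints
    match.\<close>
  have end0: "right_orbit G0 (f y) = f ` star0 Y (end0 Y y)" if y: "y \<in> edges Y" for y
    using y by (simp add: H.end0_Y_comb[OF f_closed[OF y]] star0_end0) (simp add: flip_edge_eq_act f_mult)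
  have end1: "right_orbit G1 (f y) = f ` star1 Y (end1 Y y)" if y: "y \<in> edges Y" for y
    using y by (simp add: H.end1_Y_comb[OF f_closed[OF y]] star1_end1 f_turn)
  have star_sub: "star0 Y v \<subseteq> edges Y" "star1 Y w \<subseteq> edges Y" for v w
    by (auto simp: star0_def star1_def)
  have bij0: "bij_betw (\<lambda>v. f ` star0 Y v) (verts0 Y) (verts0 (Y_comb H))"
  proof (rule bij_betw_imageI)
    show "inj_on (\<lambda>v. f ` star0 Y v) (verts0 Y)"
    proof (rule inj_onI)
      fix v v' assume "v \<in> verts0 Y" "f ` star0 Y v = f ` star0 Y v'"
      then have "star0 Y v = star0 Y v'" "star0 Y v \<noteq> {}"
        using inj_on_image_eq_iff[OF inj star_sub(1) star_sub(1)] star0_nonempty by auto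
      then show "v = v'" by (auto simp: star0_def)
    qed
    show "(\<lambda>v. f ` star0 Y v) ` verts0 Y = verts0 (Y_comb H)"
      unfolding verts_eq Y_comb_simps surj[symmetric] image_image using end0 by simp
  qed
  have bij1: "bij_betw (\<lambda>v. f ` star1 Y v) (verts1 Y) (verts1 (Y_comb H))"
  proof (rule bij_betw_imageI)
    show "inj_on (\<lambda>v. f ` star1 Y v) (verts1 Y)"
    proof (rule inj_onI)
      fix v v' assume "v \<in> verts1 Y" "f ` star1 Y v = f ` star1 Y v'"
      then have "star1 Y v = star1 Y v'" "star1 Y v \<noteq> {}"
        using inj_on_image_eq_iff[OF inj star_sub(2) star_sub(2)] star1_nonempty by auto
      then show "v = v'" by (auto simp: star1_def)
    qed
    show "(\<lambda>v. f ` star1 Y v) ` verts1 Y = verts1 (Y_comb H)"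
      unfolding verts_eq Y_comb_simps surj[symmetric] image_image using end1 by simp
  qed
  have cyc: "(a, b, c) \<in> cyc Y v \<longleftrightarrow> (f a, f b, f c) \<in> cyc (Y_comb H) (f ` star1 Y v)"
    if 3: "card (star1 Y v) = 3" and a: "a \<in> star1 Y v" and b: "b \<in> star1 Y v" and c: "c \<in> star1 Y v" for v a b c
  proof -
    have edges: "a \<in> edges Y" "b \<in> edges Y" "c \<in> edges Y" using a b c star_sub by blast+
    have "(f a, f b, f c) \<in> cyc (Y_comb H) (f ` star1 Y v) \<longleftrightarrow>
        f b = f a #>\<^bsub>PSL2Z\<^esub> u_elt \<and> f c = f a #>\<^bsub>PSL2Z\<^esub> u_elt #>\<^bsub>PSL2Z\<^esub> u_elt"
      using a by auto
    also have "\<dots> \<longleftrightarrow> f b = f (turn_edge Y a) \<and> f c = f (turn_edge Y (turn_edge Y a))"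
      using edges by (simp add: f_turn turn_edge_closed)
    also have "\<dots> \<longleftrightarrow> b = turn_edge Y a \<and> c = turn_edge Y (turn_edge Y a)"
      using edges by (simp add: inj_on_eq_iff[OF inj] turn_edge_closed)
    finally show ?thesis using cyc_iff[OF 3 a] by simp
  qed
  have "cuboid_iso Y (Y_comb H) (f, \<lambda>v. f ` star0 Y v, \<lambda>v. f ` star1 Y v)"
    unfolding cuboid_iso.simps
    using bij_betw_imageI[OF inj surj] bij0 bij1 end0 end1 cyc by (simp del: Y_comb_simps(2,3,6))
  moreover have "f e = H"
    using f_act[OF PSL2Z.one_closed] e H.G_subset by (simp add: act_one)
  ultimately show ?thesis
    unfolding H_def[symmetric] pointed_Y_comb_def base_edge_def pointed_isomorphic.simps by blast
qed

end

text \<open>If the stabilisers agree, both pointed graphs are isomorphic to the coset graph of that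
  one subgroup, and the two isomorphisms are composed.\<close>

lemma pointed_isomorphic_iff_edge_stab:
  assumes Y: "bipartite_cuboid_graph Y" "e \<in> edges Y" and Z: "bipartite_cuboid_graph Z" "e' \<in> edges Z"
  shows "pointed_isomorphic (Y, e) (Z, e') \<longleftrightarrow> edge_stab Y e = edge_stab Z e'"
proof
  assume "pointed_isomorphic (Y, e) (Z, e')"
  then obtain f f0 f1 where "cuboid_iso Y Z (f, f0, f1)" "f e = e'"
    unfolding pointed_isomorphic.simps by blast
  then show "edge_stab Y e = edge_stab Z e'"
    using iso_edge_stab[OF Y(1) Z(1) _ Y(2)] by metis
next
  assume stab: "edge_stab Y e = edge_stab Z e'"
  let ?H = "edge_stab Y e"
  have "pointed_isomorphic (Y, e) (Y_comb ?H, ?H)" "pointed_isomorphic (Z, e') (Y_comb ?H, ?H)"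
    using cuboid.pointed_isomorphic_Y_comb[OF cuboid.intro[OF Y(1)] Y(2)]
      cuboid.pointed_isomorphic_Y_comb[OF cuboid.intro[OF Z(1)] Z(2)]
    by (simp_all only: pointed_Y_comb_def base_edge_def stab)
  from pointed_isomorphic_trans[OF Y(1) this(1) pointed_isomorphic_sym[OF Z this(2)]]
  show "pointed_isomorphic (Y, e) (Z, e')" .
qed

lemma orbit_Aut:
  assumes Y: "bipartite_cuboid_graph Y" and x: "x \<in> edges Y"
  shows "orbit (Aut Y) fst x = {y \<in> edges Y. edge_stab Y y = edge_stab Y x}"
proof -
  interpret group_action "Aut Y" "edges Y" fst by (rule group_action_Aut[OF Y])
  have "y \<in> orbit (Aut Y) fst x \<longleftrightarrow> y \<in> edges Y \<and> pointed_isomorphic (Y, x) (Y, y)" for y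
    unfolding orbit_def pointed_isomorphic_iff_Aut[OF Y x] using x element_image by blast
  then show ?thesis
    using pointed_isomorphic_iff_edge_stab[OF Y x Y] by (auto simp del: pointed_isomorphic.simps)
qed

lemma transitive_Aut_iff:
  assumes Y: "bipartite_cuboid_graph Y"
  shows "transitive_action (Aut Y) (edges Y) fst \<longleftrightarrow>
    (\<forall>x\<in>edges Y. \<forall>y\<in>edges Y. edge_stab Y x = edge_stab Y y)"
  unfolding transitive_action_def transitive_action_axioms_def
  using group_action_Aut[OF Y] pointed_isomorphic_iff_Aut[OF Y] pointed_isomorphic_iff_edge_stab[OF Y _ Y]
  by (simp del: pointed_isomorphic.simps) blast

section \<open>Conjugacy classes and normality\<close>

lemma edge_stab_conjugacy_class:
  assumes "subgroup G PSL2Z"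
  shows "edge_stab (Y_comb G) ` edges (Y_comb G) = conjugacy_class G"
proof -
  interpret psl_subgroup G by (rule psl_subgroup.intro) fact
  have "edge_stab (Y_comb G) ` edges (Y_comb G) =
      {inv\<^bsub>PSL2Z\<^esub> x <#\<^bsub>PSL2Z\<^esub> G #>\<^bsub>PSL2Z\<^esub> x | x. x \<in> carrier PSL2Z}"
    using edge_stab_Y_comb by (auto simp: RCOSETS_def)
  also have "\<dots> = conjugacy_class G"
    \<comment> \<open>Stabilisers appear as conjugates by the inverse of x, while the class is
      written with x first; replacing x by its inverse reconciles the two.\<close>
    unfolding conjugacy_class_def by (metis (no_types, opaque_lifting) PSL2Z.inv_closed PSL2Z.inv_inv)
  finally show ?thesis .
qed

lemma normal_iff_conjugacy_class:
  assumes G: "subgroup G PSL2Z"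
  shows "G \<lhd> PSL2Z \<longleftrightarrow> conjugacy_class G = {G}"
proof -
  interpret psl_subgroup G by (rule psl_subgroup.intro) fact
  show ?thesis
  proof
    assume "G \<lhd> PSL2Z"
    then have "x <#\<^bsub>PSL2Z\<^esub> G #>\<^bsub>PSL2Z\<^esub> inv\<^bsub>PSL2Z\<^esub> x = G" if "x \<in> carrier PSL2Z" for x
      using that normal.coset_eq[of G PSL2Z] G_subset by (metis PSL2Z.coset_mult_assoc PSL2Z.coset_mult_one PSL2Z.inv_closed PSL2Z.r_inv)
    then show "conjugacy_class G = {G}"
      unfolding conjugacy_class_def using PSL2Z.one_closed by blast
  next
    assume conj: "conjugacy_class G = {G}"
    have "x \<otimes>\<^bsub>PSL2Z\<^esub> h \<otimes>\<^bsub>PSL2Z\<^esub> inv\<^bsub>PSL2Z\<^esub> x \<in> G" if "x \<in> carrier PSL2Z" "h \<in> G" for x h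
    proof -
      have "x \<otimes>\<^bsub>PSL2Z\<^esub> h \<otimes>\<^bsub>PSL2Z\<^esub> inv\<^bsub>PSL2Z\<^esub> x \<in> x <#\<^bsub>PSL2Z\<^esub> G #>\<^bsub>PSL2Z\<^esub> inv\<^bsub>PSL2Z\<^esub> x"
        using that unfolding l_coset_def r_coset_def by blast
      also have "\<dots> = G" using that conj unfolding conjugacy_class_def by blast
      finally show ?thesis .
    qed
    then show "G \<lhd> PSL2Z" using G by (simp add: PSL2Z.normal_inv_iff)
  qed
qed

section \<open>Isomorphism classes as fibres of the stabiliser map\<close>

lemma pointed_Y_comb_mem: "subgroup G PSL2Z \<Longrightarrow> pointed_Y_comb G \<in> pointed_cuboid_graphs"
  using psl_subgroup.cuboid_Y_comb[of G] psl_subgroup.base_edge_in_edges[of G]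
  by (simp add: pointed_cuboid_graphs_def pointed_Y_comb_def base_edge_def psl_subgroup_def)

definition pointed_stab :: "('e, 'v, 'w) bigraph \<times> 'e \<Rightarrow> (int^2^2) set set" where
  "pointed_stab p = edge_stab (fst p) (snd p)"

lemma pointed_stab_Y_comb: "subgroup G PSL2Z \<Longrightarrow> pointed_stab (pointed_Y_comb G) = G"
  using psl_subgroup.edge_stab_base_edge[of G]
  by (simp add: pointed_stab_def pointed_Y_comb_def base_edge_def psl_subgroup_def)

lemma subgroup_pointed_stab: "p \<in> pointed_cuboid_graphs \<Longrightarrow> subgroup (pointed_stab p) PSL2Z"
  using cuboid.subgroup_edge_stab[OF cuboid.intro]
  by (auto simp: pointed_cuboid_graphs_def pointed_stab_def)

lemma pointed_isomorphic_iff_pointed_stab: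
  "p \<in> pointed_cuboid_graphs \<Longrightarrow> q \<in> pointed_cuboid_graphs \<Longrightarrow>
    pointed_isomorphic p q \<longleftrightarrow> pointed_stab p = pointed_stab q"
  by (auto simp: pointed_cuboid_graphs_def pointed_stab_def pointed_isomorphic_iff_edge_stab
      simp del: pointed_isomorphic.simps)

lemma pointed_iso_rel_image:
  "p \<in> pointed_cuboid_graphs \<Longrightarrow>
    pointed_iso_rel `` {p} = {q \<in> pointed_cuboid_graphs. pointed_stab q = pointed_stab p}"
  by (auto simp: pointed_iso_rel_def pointed_isomorphic_iff_pointed_stab)

text \<open>Each class is a fibre of \<open>pointed_stab\<close>, and G is recovered from its own
  graph by \<open>pointed_stab\<close>. The classes are taken over the types of the coset graphs,
  where every class contains a coset graph.\<close>

lemma bij_betw_pointed_classes: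
  "bij_betw (\<lambda>G. pointed_iso_rel `` {pointed_Y_comb G})
     {G. subgroup G PSL2Z} (pointed_cuboid_graphs // pointed_iso_rel)"
proof (rule bij_betw_imageI)
  have cls: "pointed_iso_rel `` {pointed_Y_comb G} = {q \<in> pointed_cuboid_graphs. pointed_stab q = G}"
    if "subgroup G PSL2Z" for G
    by (simp add: pointed_iso_rel_image pointed_Y_comb_mem pointed_stab_Y_comb that)
  show "inj_on (\<lambda>G. pointed_iso_rel `` {pointed_Y_comb G}) {G. subgroup G PSL2Z}"
  proof (rule inj_onI)
    fix G H assume G: "G \<in> {G. subgroup G PSL2Z}" and H: "H \<in> {G. subgroup G PSL2Z}"
      and eq: "pointed_iso_rel `` {pointed_Y_comb G} = pointed_iso_rel `` {pointed_Y_comb H}"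
    have "pointed_Y_comb G \<in> {q \<in> pointed_cuboid_graphs. pointed_stab q = G}"
      using G by (simp add: pointed_Y_comb_mem pointed_stab_Y_comb)
    also have "\<dots> = {q \<in> pointed_cuboid_graphs. pointed_stab q = H}"
      using eq G H by (simp only: cls mem_Collect_eq)
    finally have "pointed_stab (pointed_Y_comb G) = H" by blast
    then show "G = H" using G by (simp add: pointed_stab_Y_comb)
  qed
  show "(\<lambda>G. pointed_iso_rel `` {pointed_Y_comb G}) ` {G. subgroup G PSL2Z} = pointed_cuboid_graphs // pointed_iso_rel"
  proof (intro equalityI subsetI)
    fix X assume "X \<in> (\<lambda>G. pointed_iso_rel `` {pointed_Y_comb G}) ` {G. subgroup G PSL2Z}"
    then show "X \<in> pointed_cuboid_graphs // pointed_iso_rel"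
      using pointed_Y_comb_mem by (auto intro: quotientI)
  next
    fix X :: "(((int^2^2) set set, (int^2^2) set set set, (int^2^2) set set set) bigraph \<times> (int^2^2) set set) set"
    assume "X \<in> pointed_cuboid_graphs // pointed_iso_rel"
    then obtain p where p: "p \<in> pointed_cuboid_graphs" "X = pointed_iso_rel `` {p}" by (rule quotientE)
    then have "X = pointed_iso_rel `` {pointed_Y_comb (pointed_stab p)}"
      by (simp add: pointed_iso_rel_image cls subgroup_pointed_stab)
    then show "X \<in> (\<lambda>G. pointed_iso_rel `` {pointed_Y_comb G}) ` {G. subgroup G PSL2Z}"
      using subgroup_pointed_stab[OF p(1)] by blast
  qed
qed

text \<open>Here the types of Y are arbitrary. The stabiliser of e is the required subgroup, and it
  is the only candidate because stabilisers are isomorphism invariants.\<close>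

lemma ex1_subgroup_pointed_isomorphic:
  assumes "(Y, e) \<in> pointed_cuboid_graphs"
  shows "\<exists>!G. subgroup G PSL2Z \<and> pointed_isomorphic (Y, e) (pointed_Y_comb G)"
proof -
  have "subgroup G PSL2Z \<and> pointed_isomorphic (Y, e) (pointed_Y_comb G) \<longleftrightarrow> G = pointed_stab (Y, e)" for G
    using assms subgroup_pointed_stab[OF assms]
    by (metis pointed_isomorphic_iff_pointed_stab pointed_Y_comb_mem pointed_stab_Y_comb)
  then show ?thesis by simp
qed

lemma orbits_bij_conjugacy_class:
  assumes G: "subgroup G PSL2Z"
  shows "\<exists>\<beta>. bij_betw \<beta> (orbits (Aut (Y_comb G)) (edges (Y_comb G)) fst) (conjugacy_class G) \<and>
    (\<forall>x \<in> edges (Y_comb G). pointed_isomorphic (Y_comb G, x)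
      (pointed_Y_comb (\<beta> (orbit (Aut (Y_comb G)) fst x))))"
proof -
  interpret psl_subgroup G by (rule psl_subgroup.intro) fact
  let ?Y = "Y_comb G" and ?orb = "orbit (Aut (Y_comb G)) fst"
  \<comment> \<open>The value does not depend on the representative, since an orbit is exactly the
    set of edges with a given stabiliser. The same fact makes the map injective.\<close>
  define \<beta> where "\<beta> X = edge_stab ?Y (SOME x. x \<in> X)" for X
  note orb = orbit_Aut[OF cuboid_Y_comb]
  have \<beta>: "\<beta> (?orb x) = edge_stab ?Y x" if "x \<in> edges ?Y" for x
  proof -
    have "x \<in> ?orb x" using that by (simp only: orb) simp
    then have "(SOME y. y \<in> ?orb x) \<in> ?orb x" by (rule someI)
    then show ?thesis unfolding \<beta>_def using orb[OF that] by blast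
  qed
  have orbits: "orbits (Aut ?Y) (edges ?Y) fst = ?orb ` edges ?Y" by (auto simp: orbits_def)
  have "bij_betw \<beta> (orbits (Aut ?Y) (edges ?Y) fst) (conjugacy_class G)"
  proof (rule bij_betw_imageI)
    show "inj_on \<beta> (orbits (Aut ?Y) (edges ?Y) fst)"
      unfolding orbits
    proof (rule inj_onI, elim imageE)
      fix X X' x x' assume "\<beta> X = \<beta> X'" and x: "X = ?orb x" "x \<in> edges ?Y" and x': "X' = ?orb x'" "x' \<in> edges ?Y"
      then have "edge_stab ?Y x = edge_stab ?Y x'" using \<beta> by metis
      then show "X = X'" unfolding x(1) x'(1) by (simp only: orb x(2) x'(2))
    qed
    show "\<beta> ` orbits (Aut ?Y) (edges ?Y) fst = conjugacy_class G"
      unfolding orbits image_image edge_stab_conjugacy_class[OF G, symmetric] using \<beta> by (rule image_cong[OF refl])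
  qed
  moreover have "pointed_isomorphic (?Y, x) (pointed_Y_comb (\<beta> (?orb x)))" if "x \<in> edges ?Y" for x
    using pointed_isomorphic_Y_comb[OF that] \<beta>[OF that] by (simp only:)
  ultimately show ?thesis by blast
qed

text \<open>Transitivity says that \<open>edge_stab\<close> is constant. Its image is the conjugacy
  class of G and contains G, so this means that the class is {G}.\<close>

lemma normal_iff_transitive_Aut:
  assumes G: "subgroup G PSL2Z"
  shows "G \<lhd> PSL2Z \<longleftrightarrow> transitive_action (Aut (Y_comb G)) (edges (Y_comb G)) fst"
proof -
  interpret psl_subgroup G by (rule psl_subgroup.intro) fact
  have image_eq: "(\<forall>x\<in>A. \<forall>y\<in>A. f x = f y) \<longleftrightarrow> f ` A = {f a}" if "a \<in> A"
    for f :: "(int^2^2) set set \<Rightarrow> (int^2^2) set set" and A a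
  proof
    assume "f ` A = {f a}"
    then have "f x = f a" if "x \<in> A" for x using that by blast
    then show "\<forall>x\<in>A. \<forall>y\<in>A. f x = f y" by simp
  qed (use that in blast)
  have "transitive_action (Aut (Y_comb G)) (edges (Y_comb G)) fst \<longleftrightarrow>
      edge_stab (Y_comb G) ` edges (Y_comb G) = {edge_stab (Y_comb G) G}"
    unfolding transitive_Aut_iff[OF cuboid_Y_comb] using base_edge_in_edges by (intro image_eq) simp
  then show ?thesis
    by (simp only: edge_stab_conjugacy_class[OF G] edge_stab_base_edge normal_iff_conjugacy_class[OF G])
qed

theorem theorem3p2:
  shows
    "bij_betw (\<lambda>G. pointed_iso_rel `` {pointed_Y_comb G})
       {G. subgroup G PSL2Z} (pointed_cuboid_graphs // pointed_iso_rel)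
     \<and> (\<forall>(Y :: ('e, 'v, 'w) bigraph) e. (Y, e) \<in> pointed_cuboid_graphs \<longrightarrow>
          (\<exists>!G. subgroup G PSL2Z \<and> pointed_isomorphic (Y, e) (pointed_Y_comb G)))
     \<and> (\<forall>G. subgroup G PSL2Z \<longrightarrow>
          (\<exists>\<beta>. bij_betw \<beta> (orbits (Aut (Y_comb G)) (edges (Y_comb G)) fst) (conjugacy_class G) \<and>
               (\<forall>x \<in> edges (Y_comb G).
                  pointed_isomorphic (Y_comb G, x)
                    (pointed_Y_comb (\<beta> (orbit (Aut (Y_comb G)) fst x)))))
          \<and> (G \<lhd> PSL2Z \<longleftrightarrow>
               transitive_action (Aut (Y_comb G)) (edges (Y_comb G)) fst))"
  by (intro conjI allI impI bij_betw_pointed_classes ex1_subgroup_pointed_isomorphic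
      orbits_bij_conjugacy_class normal_iff_transitive_Aut)

end
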